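(* Let $(\Omega,\mathcal F)$ be a measurable space such that $\mathcal F$ contains at least three pairwise disjoint non-null events, and let $\succeq$ be a preference order on $\mathcal L^\infty(\Omega,\mathcal F)$ satisfying (SM), (PC) and (ST). Then there exist a probability measure $\mathbb P$ on $(\Omega,\mathcal F)$ with $\mathcal N_\succeq=\{A\in\mathcal F:\mathbb P(A)=0\}$ and an $\mathcal F$-regular function $\mathbb u:\Omega\times\mathbb R\to\mathbb R$ with $\mathbb u(\cdot,x)\in\mathcal L^1(\Omega,\mathcal F,\mathbb P)$ for every $x\in\mathbb R$, such that for all $f,g\in\mathcal L^\infty(\Omega,\mathcal F)$, $$f\succeq g\iff \int_\Omega\mathbb u(\omega,f(\omega))\,\mathbb P(d\omega)\ge\int_\Omega\mathbb u(\omega,g(\omega))\,\mathbb P(d\omega).$$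
   Context: $\mathcal L^\infty(\Omega,\mathcal F)$: bounded $\mathcal F$-measurable real functions. Preference order: complete transitive relation; $\succ,\sim$ as usual. Null events $\mathcal N_\succeq=\{A\in\mathcal F: f1_A+g1_{A^c}\sim g\ \forall f,g\}$; non-null means not in $\mathcal N_\succeq$. (SM): for non-null $A$, every $f$ and constants $x>y$: $x1_A+f1_{A^c}\succ y1_A+f1_{A^c}$. (ST): if $f1_A+h1_{A^c}\succeq g1_A+h1_{A^c}$ then $f1_A+\tilde h1_{A^c}\succeq g1_A+\tilde h1_{A^c}$ for every $\tilde h$. (PC): for uniformly bounded $f_n\to f$ pointwise and $g\succ f$ (resp. $f\succ g$) there is $N$ with $g\succ f_n$ (resp. $f_n\succ g$) for $n>N$. A function $\varphi:\Omega\times\mathbb R\to\mathbb R$ is $\mathcal F$-regular if $\varphi(\omega,\cdot)$ is continuous and strictly increasing on $\mathbb R$ for every $\omega$, $\varphi(\omega,0)=0$ for every $\omega$, and $\varphi$ is $\mathcal F\otimes\mathcal B_{\mathbb R}$-measurable. *)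

theory Defs
  imports "HOL-Probability.Probability"
begin

text \<open>The sample space Omega is the whole type 'a (space M = UNIV).\<close>

definition Linf :: "'a measure \<Rightarrow> ('a \<Rightarrow> real) set" where
  "Linf M = {f. f \<in> borel_measurable M \<and> bounded (range f)}"

definition mix :: "'a set \<Rightarrow> ('a \<Rightarrow> real) \<Rightarrow> ('a \<Rightarrow> real) \<Rightarrow> ('a \<Rightarrow> real)" where
  "mix A f g = (\<lambda>\<omega>. if \<omega> \<in> A then f \<omega> else g \<omega>)"

definition pref_order :: "'a measure \<Rightarrow> (('a \<Rightarrow> real) \<Rightarrow> ('a \<Rightarrow> real) \<Rightarrow> bool) \<Rightarrow> bool" where
  "pref_order M R \<longleftrightarrow>
     (\<forall>f\<in>Linf M. \<forall>g\<in>Linf M. R f g \<or> R g f) \<and>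
     (\<forall>f\<in>Linf M. \<forall>g\<in>Linf M. \<forall>h\<in>Linf M. R f g \<longrightarrow> R g h \<longrightarrow> R f h)"

definition strict_pref :: "(('a \<Rightarrow> real) \<Rightarrow> ('a \<Rightarrow> real) \<Rightarrow> bool) \<Rightarrow> ('a \<Rightarrow> real) \<Rightarrow> ('a \<Rightarrow> real) \<Rightarrow> bool" where
  "strict_pref R f g \<longleftrightarrow> R f g \<and> \<not> R g f"

definition indiff :: "(('a \<Rightarrow> real) \<Rightarrow> ('a \<Rightarrow> real) \<Rightarrow> bool) \<Rightarrow> ('a \<Rightarrow> real) \<Rightarrow> ('a \<Rightarrow> real) \<Rightarrow> bool" where
  "indiff R f g \<longleftrightarrow> R f g \<and> R g f"

definition null_events :: "'a measure \<Rightarrow> (('a \<Rightarrow> real) \<Rightarrow> ('a \<Rightarrow> real) \<Rightarrow> bool) \<Rightarrow> 'a set set" where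
  "null_events M R = {A \<in> sets M. \<forall>f\<in>Linf M. \<forall>g\<in>Linf M. indiff R (mix A f g) g}"

definition SM :: "'a measure \<Rightarrow> (('a \<Rightarrow> real) \<Rightarrow> ('a \<Rightarrow> real) \<Rightarrow> bool) \<Rightarrow> bool" where
  "SM M R \<longleftrightarrow> (\<forall>A \<in> sets M - null_events M R. \<forall>f\<in>Linf M. \<forall>x y :: real. x > y \<longrightarrow>
      strict_pref R (mix A (\<lambda>_. x) f) (mix A (\<lambda>_. y) f))"

definition ST :: "'a measure \<Rightarrow> (('a \<Rightarrow> real) \<Rightarrow> ('a \<Rightarrow> real) \<Rightarrow> bool) \<Rightarrow> bool" where
  "ST M R \<longleftrightarrow> (\<forall>A \<in> sets M. \<forall>f\<in>Linf M. \<forall>g\<in>Linf M. \<forall>h\<in>Linf M. \<forall>h'\<in>Linf M.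
      R (mix A f h) (mix A g h) \<longrightarrow> R (mix A f h') (mix A g h'))"

definition PC :: "'a measure \<Rightarrow> (('a \<Rightarrow> real) \<Rightarrow> ('a \<Rightarrow> real) \<Rightarrow> bool) \<Rightarrow> bool" where
  "PC M R \<longleftrightarrow> (\<forall>fs f g. (\<forall>n. fs n \<in> Linf M) \<longrightarrow> f \<in> Linf M \<longrightarrow> g \<in> Linf M \<longrightarrow>
      (\<exists>B. \<forall>n \<omega>. \<bar>fs n \<omega>\<bar> \<le> B) \<longrightarrow> (\<forall>\<omega>. (\<lambda>n. fs n \<omega>) \<longlonglongrightarrow> f \<omega>) \<longrightarrow>
      (strict_pref R g f \<longrightarrow> (\<exists>N. \<forall>n>N. strict_pref R g (fs n))) \<and>
      (strict_pref R f g \<longrightarrow> (\<exists>N. \<forall>n>N. strict_pref R (fs n) g)))"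

definition F_regular :: "'a measure \<Rightarrow> ('a \<Rightarrow> real \<Rightarrow> real) \<Rightarrow> bool" where
  "F_regular M u \<longleftrightarrow> (\<forall>\<omega>. continuous_on UNIV (u \<omega>) \<and> strict_mono (u \<omega>) \<and> u \<omega> 0 = 0) \<and>
      (\<lambda>(\<omega>, x). u \<omega> x) \<in> borel_measurable (M \<Otimes>\<^sub>M borel)"

end

theory Submission
  imports Defs
begin

text \<open>
  Restricted to acts that are constant on the cells of a partition into three non-null events, the
  preference becomes an order on triples of reals that is strictly increasing, continuous and
  independent, so it has an additive representation (Debreu). Here this is obtained by counting:
  a small step in the second coordinate serves as a measuring stick for the first and the third
  coordinate, the sticks are halved repeatedly, and the number of sticks that fit into an interval,
  divided by \<open>2 ^ k\<close>, converges to its length. Such counts make sense even if the coordinate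
  utilities turn out to be bounded.

  Composing the resulting utility scale with the certainty equivalent gives a functional \<open>V\<close> that
  represents the preference. The effect on \<open>V\<close> of changing an act on an event \<open>D\<close> can be
  compensated in small steps on a cell disjoint from \<open>D\<close>, hence by the sure-thing principle it does
  not depend on the act outside \<open>D\<close>. Therefore \<open>D \<mapsto> V (x 1\<^sub>D)\<close> is a countably additive set
  function for every \<open>x\<close>. Its densities at dyadic \<open>x\<close> are almost surely strictly increasing in
  \<open>x\<close>, and they have almost surely no jumps because \<open>V\<close> is continuous; they extend to the
  state-dependent utility.
\<close>

section \<open>Counting standard steps\<close>

text \<open>Three cells are what makes halving possible: two equal steps in one coordinate cannot be
  added within that coordinate, but one of them can be parked in another. A single pass of counting
  puts only two coordinates on a common scale. The remaining one has to be attached without any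
  guarantee that a change in it can be matched elsewhere, since the coordinate utilities may have
  ranges of different lengths; this is why the coordinate of smallest range is singled out. The
  certainty equivalent carries only ordinal information. The scale that makes it cardinal is the sum
  of the three utilities at \<open>t\<close>, because the constant act \<open>t\<close> is the
  triple \<open>(t, t, t)\<close>. A density is determined only up to a null set that depends on
  \<open>x\<close>. Monotonicity and absence of jumps must hold off one common null set, so they are
  imposed at countably many \<open>x\<close>. A jump on an event of positive probability would
  produce two uniformly bounded sequences of acts with the same limit whose values under
  \<open>V\<close> stay apart.\<close>

lemma inverse_power2_lim: "(\<lambda>k. 1 / 2 ^ k :: real) \<longlonglongrightarrow> 0"
  using LIMSEQ_realpow_zero[of "1/2::real"] by (simp add: power_one_over)

text \<open>A primitive of an additive interval function. The values \<open>d x y\<close> are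
  meaningful only for \<open>x \<le> y\<close>, hence the two cases.\<close>

definition potential :: "(real \<Rightarrow> real \<Rightarrow> real) \<Rightarrow> real \<Rightarrow> real" where
  "potential d x = (if 0 \<le> x then d 0 x else - d x 0)"

lemma potential_diff:
  assumes "\<And>x y z. x \<le> y \<Longrightarrow> y \<le> z \<Longrightarrow> d x z = d x y + d y z" and "x \<le> y"
  shows "potential d y - potential d x = d x y"
  using assms(1)[of 0 x y] assms(1)[of x 0 y] assms(1)[of x y 0] assms(2)
  unfolding potential_def by auto

text \<open>Moving the first coordinate from \<open>x\<close> to \<open>x'\<close> is worth as much
  as raising the second from \<open>0\<close> to \<open>b\<close>. This is a relation because a
  bounded range may leave \<open>x\<close> without a successor; its powers are chains of
  sticks.\<close>

definition std_step :: "(real \<Rightarrow> real \<Rightarrow> real) \<Rightarrow> real \<Rightarrow> (real \<times> real) set" where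
  "std_step F b = {(x, x'). F x' 0 = F x b}"

definition step_counts :: "(real \<Rightarrow> real \<Rightarrow> real) \<Rightarrow> real \<Rightarrow> real \<Rightarrow> real \<Rightarrow> nat set" where
  "step_counts F b x x' = {n. \<exists>y\<le>x'. (x, y) \<in> std_step F b ^^ n}"

definition step_count :: "(real \<Rightarrow> real \<Rightarrow> real) \<Rightarrow> real \<Rightarrow> real \<Rightarrow> real \<Rightarrow> nat" where
  "step_count F b x x' = Max (step_counts F b x x')"

locale bimonotone =
  fixes F :: "real \<Rightarrow> real \<Rightarrow> real"
  assumes mono1: "\<And>x x' y. x < x' \<Longrightarrow> F x y < F x' y"
    and mono2: "\<And>x y y'. y < y' \<Longrightarrow> F x y < F x y'"
    and cont1: "\<And>y. continuous_on UNIV (\<lambda>x. F x y)"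
    and cont2: "\<And>x. continuous_on UNIV (F x)"
begin

lemma less1_iff: "F x y < F x' y \<longleftrightarrow> x < x'"
  using mono1[of x x' y] mono1[of x' x y] by (cases x x' rule: linorder_cases) auto

lemma le1_iff: "F x y \<le> F x' y \<longleftrightarrow> x \<le> x'"
  using less1_iff[of x' y x] by linarith

lemma step_gt: "0 < b \<Longrightarrow> (x, x') \<in> std_step F b \<Longrightarrow> x < x'"
  using mono2[of 0 b x] less1_iff[of x 0 x'] by (auto simp: std_step_def)

text \<open>\<open>F x b\<close> lies between \<open>F x 0\<close> and \<open>F w' 0\<close>, so the
  intermediate value theorem applies. A chain can therefore be moved to an earlier start without
  losing steps, which is what the comparisons of counts rest on.\<close>

lemma step_below:
  assumes b: "0 < b" and w: "(w, w') \<in> std_step F b" and "x \<le> w"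
  shows "\<exists>x'\<le>w'. (x, x') \<in> std_step F b"
proof -
  have 1: "F x 0 \<le> F x b" using mono2[OF b] less_imp_le by blast
  have 2: "F x b \<le> F w' 0" using w assms(3) le1_iff[of x b w] by (simp add: std_step_def)
  have 3: "x \<le> w'" using step_gt[OF b w] assms(3) by simp
  obtain x' where "x' \<le> w'" "F x' 0 = F x b"
    using IVT'[of "\<lambda>x. F x 0" x "F x b" w', OF 1 2 3] continuous_on_subset[OF cont1] by blast
  then show ?thesis by (auto simp: std_step_def)
qed

lemma steps_below:
  assumes b: "0 < b"
  shows "(w, w') \<in> std_step F b ^^ n \<Longrightarrow> x \<le> w \<Longrightarrow> \<exists>x'\<le>w'. (x, x') \<in> std_step F b ^^ n"
proof (induction n arbitrary: w')
  case 0 then show ?case by auto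
next
  case (Suc n)
  then obtain v where v: "(w, v) \<in> std_step F b ^^ n" "(v, w') \<in> std_step F b" by auto
  then obtain y where y: "y \<le> v" "(x, y) \<in> std_step F b ^^ n" using Suc by blast
  then obtain x' where "x' \<le> w'" "(y, x') \<in> std_step F b" using step_below[OF b v(2) y(1)] by blast
  then show ?case using y by auto
qed

lemma steps_ge: "0 < b \<Longrightarrow> (x, y) \<in> std_step F b ^^ n \<Longrightarrow> x \<le> y"
proof (induction n arbitrary: y)
  case (Suc n)
  then show ?case using step_gt by fastforce
qed auto

text \<open>The Archimedean property comes from compactness: on \<open>[x, x']\<close> the gain
  \<open>F y b - F y 0\<close> has a positive minimum \<open>m\<close>, and by uniform continuity of
  \<open>F\<close> at second coordinate \<open>0\<close> a gain of \<open>m\<close> requires a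
  displacement of at least some \<open>d > 0\<close>.\<close>

lemma step_counts_finite:
  assumes b: "0 < b"
  shows "finite (step_counts F b x x')"
proof (cases "x \<le> x'")
  case True
  have c: "continuous_on {x..x'} (\<lambda>y. F y b - F y 0)"
    by (intro continuous_on_diff continuous_on_subset[OF cont1]) auto
  obtain p where p: "p \<in> {x..x'}" "\<And>y. y \<in> {x..x'} \<Longrightarrow> F p b - F p 0 \<le> F y b - F y 0"
    using continuous_attains_inf[OF _ _ c] True by auto
  define m where "m = F p b - F p 0"
  have m: "m > 0" using mono2[OF b] by (simp add: m_def)
  have "uniformly_continuous_on {x..x'} (\<lambda>y. F y 0)"
    by (intro compact_uniformly_continuous continuous_on_subset[OF cont1]) auto
  then obtain d where d: "d > 0"
    "\<And>y y'. y \<in> {x..x'} \<Longrightarrow> y' \<in> {x..x'} \<Longrightarrow> dist y' y < d \<Longrightarrow> dist (F y' 0) (F y 0) < m"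
    unfolding uniformly_continuous_on_def using m by metis
  have step: "y' \<ge> y + d" if "(y, y') \<in> std_step F b" "x \<le> y" "y' \<le> x'" for y y'
  proof (rule ccontr)
    assume "\<not> y' \<ge> y + d"
    moreover have "y < y'" using step_gt[OF b that(1)] .
    ultimately have "dist (F y' 0) (F y 0) < m" using d(2)[of y y'] that by (auto simp: dist_real_def)
    moreover have "F y' 0 - F y 0 = F y b - F y 0" using that(1) by (simp add: std_step_def)
    ultimately have "F y b - F y 0 < m" by (simp add: dist_real_def)
    moreover have "y \<in> {x..x'}" using that \<open>y < y'\<close> by simp
    ultimately show False using p(2)[of y] by (simp add: m_def)
  qed
  have *: "y \<ge> x + n * d" if "(x, y) \<in> std_step F b ^^ n" "y \<le> x'" for n y
    using that
  proof (induction n arbitrary: y)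
    case (Suc n)
    then obtain v where v: "(x, v) \<in> std_step F b ^^ n" "(v, y) \<in> std_step F b" by auto
    have "v < y" using step_gt[OF b v(2)] .
    then show ?case using Suc.IH[OF v(1)] Suc.prems(2) step[OF v(2)] steps_ge[OF b v(1)]
      by (auto simp: algebra_simps)
  qed auto
  have "n \<le> nat \<lceil>(x' - x) / d\<rceil>" if "n \<in> step_counts F b x x'" for n
  proof -
    have "n * d \<le> x' - x" using that * by (force simp: step_counts_def)
    then have "real n \<le> (x' - x) / d" using d(1) by (simp add: field_simps)
    then show ?thesis by linarith
  qed
  then show ?thesis by (meson finite_nat_set_iff_bounded_le)
next
  case False
  then have "step_counts F b x x' = {}" using steps_ge[OF b] by (force simp: step_counts_def)
  then show ?thesis by simp
qed

text \<open>A chain of \<open>n + k\<close> steps begins with a chain of \<open>n\<close> steps, so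
  the set of counts is a finite initial segment. Later estimates can then exhibit chains instead of
  reasoning about \<open>Max\<close>.\<close>

lemma le_step_count_iff:
  assumes b: "0 < b" and "x \<le> x'"
  shows "n \<le> step_count F b x x' \<longleftrightarrow> n \<in> step_counts F b x x'"
proof
  have 0: "0 \<in> step_counts F b x x'" using assms(2) by (auto simp: step_counts_def)
  have m: "step_count F b x x' \<in> step_counts F b x x'"
    unfolding step_count_def using 0 step_counts_finite[OF b] by (intro Max_in) auto
  assume "n \<le> step_count F b x x'"
  then obtain k where k: "step_count F b x x' = n + k" using le_Suc_ex by blast
  then obtain y z where y: "(x, y) \<in> std_step F b ^^ n" "(y, z) \<in> std_step F b ^^ k" "z \<le> x'"
    using m by (auto simp: step_counts_def relpow_add)
  then have "y \<le> x'" using steps_ge[OF b y(2)] by simp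
  then show "n \<in> step_counts F b x x'" using y(1) by (auto simp: step_counts_def)
next
  assume "n \<in> step_counts F b x x'"
  then show "n \<le> step_count F b x x'"
    unfolding step_count_def using step_counts_finite[OF b] by simp
qed

lemma step_count_superadd:
  assumes b: "0 < b" and "x \<le> y" "y \<le> z"
  shows "step_count F b x y + step_count F b y z \<le> step_count F b x z"
proof -
  obtain v where v: "v \<le> y" "(x, v) \<in> std_step F b ^^ step_count F b x y"
    using le_step_count_iff[OF b \<open>x \<le> y\<close>, of "step_count F b x y"] by (auto simp: step_counts_def)
  obtain w where w: "w \<le> z" "(y, w) \<in> std_step F b ^^ step_count F b y z"
    using le_step_count_iff[OF b \<open>y \<le> z\<close>, of "step_count F b y z"] by (auto simp: step_counts_def)
  obtain w' where "w' \<le> w" "(v, w') \<in> std_step F b ^^ step_count F b y z"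
    using steps_below[OF b w(2) v(1)] by blast
  then have "step_count F b x y + step_count F b y z \<in> step_counts F b x z"
    using v w by (auto simp: step_counts_def relpow_add intro!: exI[of _ w'])
  then show ?thesis using le_step_count_iff[OF b, of x z] assms by simp
qed

text \<open>In a longest chain from \<open>x\<close>, the first point \<open>v\<close> beyond the
  steps that fit below \<open>y\<close> satisfies \<open>y \<le> v\<close>, and the rest of the
  chain can be moved back to start at \<open>y\<close>. The extra \<open>1\<close> is the stick that
  straddles \<open>y\<close>.\<close>

lemma step_count_subadd:
  assumes b: "0 < b" and "x \<le> y" "y \<le> z"
  shows "step_count F b x z \<le> step_count F b x y + step_count F b y z + 1"
proof (cases "step_count F b x z \<le> step_count F b x y")
  case False
  define m where "m = step_count F b x y"
  obtain k where k: "step_count F b x z = Suc m + k" using False le_Suc_ex[of "Suc m" "step_count F b x z"] by (auto simp: m_def)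
  have "Suc m + k \<in> step_counts F b x z" using le_step_count_iff[OF b, of x z "Suc m + k"] k assms by simp
  then obtain w where "w \<le> z" "(x, w) \<in> std_step F b ^^ (Suc m + k)"
    unfolding step_counts_def by blast
  then obtain v where v: "(x, v) \<in> std_step F b ^^ Suc m" and w: "(v, w) \<in> std_step F b ^^ k" "w \<le> z"
    unfolding relpow_add by blast
  have "Suc m \<notin> step_counts F b x y" using le_step_count_iff[OF b assms(2), of "Suc m"] by (simp add: m_def)
  then have "y \<le> v" using v unfolding step_counts_def by (auto simp del: relpow.simps) (meson linear)
  then obtain w' where "w' \<le> w" "(y, w') \<in> std_step F b ^^ k" using steps_below[OF b w(1)] by blast
  then have "k \<in> step_counts F b y z" using w unfolding step_counts_def by (blast intro: order_trans)
  then have "k \<le> step_count F b y z" using le_step_count_iff[OF b assms(3)] by simp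
  then show ?thesis using k by (simp add: m_def)
qed simp

text \<open>Chains of \<open>n\<close> long sticks are chains of \<open>2 * n\<close> short ones, so
  the long count is half of the short one, rounded down.\<close>

lemma step_count_halve:
  assumes b: "0 < b" "0 < b'" and "x \<le> y"
    and h: "std_step F b' O std_step F b' = std_step F b"
  shows "2 * step_count F b x y \<le> step_count F b' x y"
    and "step_count F b' x y \<le> 2 * step_count F b x y + 1"
proof -
  have 1: "std_step F b' ^^ (2 * n) = std_step F b ^^ n" for n
  proof (induction n)
    case (Suc n)
    have "std_step F b' ^^ (2 * Suc n) = std_step F b' ^^ (2 * n) O (std_step F b' O std_step F b')"
      by (simp add: O_assoc)
    then show ?case using Suc h by simp
  qed simp
  then have *: "n \<le> step_count F b x y \<longleftrightarrow> 2 * n \<le> step_count F b' x y" for n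
    using le_step_count_iff[OF _ assms(3)] b by (simp add: step_counts_def)
  show "2 * step_count F b x y \<le> step_count F b' x y" using * by blast
  show "step_count F b' x y \<le> 2 * step_count F b x y + 1"
    using *[of "Suc (step_count F b x y)"] by auto
qed

end

section \<open>Coordinate utility as a limit of normalised stick counts\<close>

locale stick_sequence = bimonotone +
  fixes b :: "nat \<Rightarrow> real"
  assumes b_pos: "\<And>k. 0 < b k"
    and b_halve: "\<And>k. std_step F (b (Suc k)) O std_step F (b (Suc k)) = std_step F (b k)"
    and b_lim: "b \<longlonglongrightarrow> 0"
begin

text \<open>A stick of level \<open>k\<close> is given the length \<open>1 / 2 ^ k\<close>, so a
  stick of level \<open>0\<close> is the unit.\<close>

definition "apx x y k = real (step_count F (b k) x y) / 2 ^ k"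

definition "len x y = lim (apx x y)"

definition "val = potential len"

text \<open>Halving the stick doubles the count up to an error of one. The two sequences thus
  enclose the length in nested intervals, which gives both convergence and an error bound at each
  level.\<close>

lemma apx_mono:
  assumes "x \<le> y"
  shows "incseq (apx x y)" and "decseq (\<lambda>k. apx x y k + 1 / 2 ^ k)"
proof -
  have "real (2 * step_count F (b k) x y) \<le> real (step_count F (b (Suc k)) x y)"
    "real (step_count F (b (Suc k)) x y) \<le> real (2 * step_count F (b k) x y + 1)" for k
    using step_count_halve[OF b_pos b_pos assms b_halve] by (intro of_nat_mono; blast)+
  note cnt = divide_right_mono[OF this(1), of "2 ^ Suc k" k for k] divide_right_mono[OF this(2), of "2 ^ Suc k" k for k]
  have half: "1 / 2 ^ k = 1 / (2 * 2 ^ k) + 1 / (2 * 2 ^ k :: real)" for k by (simp add: field_simps)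
  have "apx x y k \<le> apx x y (Suc k)" for k
    using cnt(1)[of k] by (simp add: apx_def)
  moreover have "apx x y (Suc k) + 1 / 2 ^ Suc k \<le> apx x y k + 1 / 2 ^ k" for k
    using cnt(2)[of k] half[of k] by (simp add: apx_def add_divide_distrib)
  ultimately  show "incseq (apx x y)" "decseq (\<lambda>k. apx x y k + 1 / 2 ^ k)"
    by (auto intro!: incseq_SucI decseq_SucI)
qed

lemma len_lim: assumes "x \<le> y" shows "apx x y \<longlonglongrightarrow> len x y"
proof -
  have "apx x y k \<le> apx x y 0 + 1" for k
  proof -
    have "apx x y k \<le> apx x y k + 1 / 2 ^ k" by simp
    also have "\<dots> \<le> apx x y 0 + 1" using decseqD[OF apx_mono(2)[OF assms], of 0 k] by simp
    finally show ?thesis .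
  qed
  then obtain L where "apx x y \<longlonglongrightarrow> L"
    using incseq_convergent[OF apx_mono(1)[OF assms], of "apx x y 0 + 1"] by blast
  then show ?thesis unfolding len_def by (simp add: limI)
qed

lemma apx_le_len: "x \<le> y \<Longrightarrow> apx x y k \<le> len x y"
  using incseq_le[OF apx_mono(1) len_lim] .

lemma len_le_apx: assumes "x \<le> y" shows "len x y \<le> apx x y k + 1 / 2 ^ k"
proof -
  have "(\<lambda>k. apx x y k + 1 / 2 ^ k) \<longlonglongrightarrow> len x y + 0"
    by (intro tendsto_add len_lim assms inverse_power2_lim)
  then show ?thesis using decseq_ge[OF apx_mono(2)[OF assms], of "len x y"] by simp
qed

lemma len_add: assumes "x \<le> y" "y \<le> z" shows "len x z = len x y + len y z"
proof (rule antisym)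
  have xz: "x \<le> z" using assms by simp
  have 1: "apx x y k + apx y z k \<le> apx x z k" for k
  proof -
    have "real (step_count F (b k) x y + step_count F (b k) y z) \<le> real (step_count F (b k) x z)"
      using step_count_superadd[OF b_pos assms] by (intro of_nat_mono)
    from divide_right_mono[OF this, of "2 ^ k"] show ?thesis by (simp add: apx_def add_divide_distrib)
  qed
  have 2: "apx x z k \<le> apx x y k + apx y z k + 1 / 2 ^ k" for k
  proof -
    have "real (step_count F (b k) x z) \<le> real (step_count F (b k) x y + step_count F (b k) y z + 1)"
      using step_count_subadd[OF b_pos assms] by (intro of_nat_mono)
    from divide_right_mono[OF this, of "2 ^ k"] show ?thesis by (simp add: apx_def add_divide_distrib)
  qed
  have t: "(\<lambda>k. apx x y k + apx y z k + 1 / 2 ^ k) \<longlonglongrightarrow> len x y + len y z + 0"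
    by (intro tendsto_add len_lim assms inverse_power2_lim)
  show "len x z \<le> len x y + len y z" using LIMSEQ_le[OF len_lim[OF xz] t] 2 by auto
  show "len x y + len y z \<le> len x z"
    by (rule LIMSEQ_le[OF tendsto_add[OF len_lim[OF assms(1)] len_lim[OF assms(2)]] len_lim[OF xz]])
      (use 1 in blast)
qed

lemma val_diff: "x \<le> y \<Longrightarrow> val y - val x = len x y"
  unfolding val_def by (rule potential_diff) (auto intro: len_add)

text \<open>Since \<open>b\<close> tends to \<open>0\<close>, a stick of some level \<open>k\<close>
  fits between \<open>x\<close> and \<open>y\<close>, which forces a length of at least
  \<open>1 / 2 ^ k\<close>.\<close>

lemma val_less: assumes "x < y" shows "val x < val y"
proof -
  have "F x 0 < F y 0" using mono1[OF assms] .
  moreover have "(\<lambda>k. F x (b k)) \<longlonglongrightarrow> F x 0"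
    using continuous_on_tendsto_compose[OF cont2 b_lim] by simp
  ultimately have "\<forall>\<^sub>F k in sequentially. F x (b k) < F y 0" by (simp add: order_tendstoD)
  then obtain k where k: "F x (b k) < F y 0" by (meson eventually_sequentially le_refl)
  have 1: "F x 0 \<le> F x (b k)" using mono2[OF b_pos] less_imp_le by blast
  obtain x' where "x' \<le> y" "F x' 0 = F x (b k)"
    using IVT'[of "\<lambda>x. F x 0" x "F x (b k)" y, OF 1] k assms continuous_on_subset[OF cont1]
    by (metis less_imp_le subset_UNIV)
  then have "1 \<in> step_counts F (b k) x y" by (auto simp: step_counts_def std_step_def)
  then have "1 \<le> step_count F (b k) x y" using le_step_count_iff[OF b_pos] assms by simp
  then have "0 < apx x y k" by (simp add: apx_def)
  then show ?thesis using apx_le_len[of x y k] val_diff[of x y] assms by simp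
qed

text \<open>If not even one stick of level \<open>k\<close> fits, the count is \<open>0\<close> and
  only the error term of that level remains. This is the source of continuity of
  \<open>val\<close>.\<close>

lemma len_small:
  assumes "x \<le> y" "F y 0 < F x (b k)"
  shows "len x y \<le> 1 / 2 ^ k"
proof -
  have "\<not> z \<le> y" if "F z 0 = F x (b k)" for z using assms(2) le1_iff[of z 0 y] that by simp
  then have "1 \<notin> step_counts F (b k) x y" by (auto simp: step_counts_def std_step_def)
  then have "\<not> 1 \<le> step_count F (b k) x y" using le_step_count_iff[OF b_pos assms(1)] by simp
  then have "step_count F (b k) x y = 0" by simp
  then show ?thesis using len_le_apx[OF assms(1), of k] by (simp add: apx_def)
qed

lemma val_cont: "continuous_on UNIV val"
  unfolding continuous_on_eq_continuous_at[OF open_UNIV] continuous_at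
proof (intro ballI tendstoI)
  fix x e :: real assume e: "0 < e"
  obtain k where k: "1 / 2 ^ k < e" using order_tendstoD(2)[OF inverse_power2_lim e] by (meson eventually_sequentially le_refl)
  have c: "((\<lambda>y. F y t) \<longlongrightarrow> F x t) (at x)" for t
    using cont1[of t] by (simp add: continuous_on_eq_continuous_at continuous_at)
  \<comment> \<open>This condition keeps a stick from fitting into \<open>[x, y]\<close> for
    \<open>y\<close> to the right of \<open>x\<close>; the next one does the same for
    \<open>[y, x]\<close> on the left.\<close>
  have "\<forall>\<^sub>F y in at x. F y 0 < F x (b k)" using order_tendstoD(2)[OF c] mono2[OF b_pos] by blast
  moreover have "\<forall>\<^sub>F y in at x. F x 0 < F y (b k)" using order_tendstoD(1)[OF c] mono2[OF b_pos] by blast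
  ultimately show "\<forall>\<^sub>F y in at x. dist (val y) (val x) < e"
  proof eventually_elim
    case (elim y)
    show ?case
    proof (cases "x \<le> y")
      case True
      then have "\<bar>val y - val x\<bar> = len x y" using val_diff[of x y] val_less[of x y] by (cases "x = y") auto
      then show ?thesis using len_small[OF True elim(1)] k by (simp add: dist_real_def)
    next
      case False
      then have "\<bar>val y - val x\<bar> = len y x" using val_diff[of y x] val_less[of y x] by simp
      then show ?thesis using len_small[of y x k] elim(2) False k by (simp add: dist_real_def)
    qed
  qed
qed

end

section \<open>Additive representation on triples of reals\<close>

text \<open>Only the order that \<open>W\<close> induces on triples matters; \<open>W\<close> itself
  need not be additive. The axioms are invariant under permutations of the coordinates, so the
  \<open>swap\<close> lemmas allow each argument to be given for one arrangement only.\<close>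

locale independent3 =
  fixes W :: "real \<Rightarrow> real \<Rightarrow> real \<Rightarrow> real"
  assumes mono1: "\<And>x x' y z. x < x' \<Longrightarrow> W x y z < W x' y z"
    and mono2: "\<And>x y y' z. y < y' \<Longrightarrow> W x y z < W x y' z"
    and mono3: "\<And>x y z z'. z < z' \<Longrightarrow> W x y z < W x y z'"
    and cont: "\<And>X Y Z x y z. X \<longlonglongrightarrow> x \<Longrightarrow> Y \<longlonglongrightarrow> y \<Longrightarrow> Z \<longlonglongrightarrow> z \<Longrightarrow>
                 (\<lambda>n. W (X n) (Y n) (Z n)) \<longlonglongrightarrow> W x y z"
    and indep1: "\<And>x t y z y' z'. W x y z \<le> W x y' z' \<Longrightarrow> W t y z \<le> W t y' z'"
    and indep2: "\<And>y t x z x' z'. W x y z \<le> W x' y z' \<Longrightarrow> W x t z \<le> W x' t z'"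
    and indep3: "\<And>z t x y x' y'. W x y z \<le> W x' y' z \<Longrightarrow> W x y t \<le> W x' y' t"
begin

lemma continuous_on_W [continuous_intros]:
  "continuous_on S f \<Longrightarrow> continuous_on S g \<Longrightarrow> continuous_on S h \<Longrightarrow>
   continuous_on S (\<lambda>t::real. W (f t) (g t) (h t))"
  unfolding continuous_on_sequentially comp_def by (auto intro!: cont)

lemma less_iff: "W x y z < W x' y z \<longleftrightarrow> x < x'" "W x y z < W x y' z \<longleftrightarrow> y < y'" "W x y z < W x y z' \<longleftrightarrow> z < z'"
  by (metis mono1 less_asym less_irrefl linorder_neqE, metis mono2 less_asym less_irrefl linorder_neqE,
      metis mono3 less_asym less_irrefl linorder_neqE)

lemma le_iff: "W x y z \<le> W x' y z \<longleftrightarrow> x \<le> x'" "W x y z \<le> W x y' z \<longleftrightarrow> y \<le> y'" "W x y z \<le> W x y z' \<longleftrightarrow> z \<le> z'"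
  using less_iff by (meson not_less)+

lemma eq_iff: "W x y z = W x' y z \<longleftrightarrow> x = x'" "W x y z = W x y' z \<longleftrightarrow> y = y'" "W x y z = W x y z' \<longleftrightarrow> z = z'"
  by (simp_all add: order.eq_iff le_iff)

lemma indep1_eq: "W x y z = W x y' z' \<Longrightarrow> W t y z = W t y' z'"
  and indep2_eq: "W x y z = W x' y z' \<Longrightarrow> W x t z = W x' t z'"
  and indep3_eq: "W x y z = W x' y' z \<Longrightarrow> W x y t = W x' y' t"
  by (intro order.antisym; rule indep1[of x] indep2[of _ y] indep3[of _ _ z]; simp)+

lemma solve1:
  assumes "W a y z \<le> t" "t \<le> W b y z"
  shows "\<exists>x. a \<le> x \<and> x \<le> b \<and> W x y z = t"
proof -
  have "a \<le> b" using order_trans[OF assms] by (simp add: le_iff)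
  moreover have "continuous_on {a..b} (\<lambda>x. W x y z)" by (intro continuous_intros)
  ultimately show ?thesis using IVT'[of "\<lambda>x. W x y z" a t b, OF assms] by blast
qed

lemma swap13: "independent3 (\<lambda>x y z. W z y x)"
  by unfold_locales (rule mono1 mono2 mono3 cont indep1 indep2 indep3; assumption)+

lemma swap12: "independent3 (\<lambda>x y z. W y x z)"
  by unfold_locales (rule mono1 mono2 mono3 cont indep1 indep2 indep3; assumption)+

lemma swap23: "independent3 (\<lambda>x y z. W x z y)"
  by unfold_locales (rule mono1 mono2 mono3 cont indep1 indep2 indep3; assumption)+

lemma solve3: "W x y a \<le> t \<Longrightarrow> t \<le> W x y b \<Longrightarrow> \<exists>z. a \<le> z \<and> z \<le> b \<and> W x y z = t"
  using independent3.solve1[OF swap13] .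

lemma solve2: "W x a z \<le> t \<Longrightarrow> t \<le> W x b z \<Longrightarrow> \<exists>y. a \<le> y \<and> y \<le> b \<and> W x y z = t"
  using independent3.solve1[OF swap12] .

text \<open>The step from \<open>0\<close> to \<open>b'\<close> in the second coordinate is matched by steps to \<open>a\<close> and \<open>c\<close> in the
  other two, and doing it twice (once in the third coordinate) amounts to the step from \<open>0\<close> to \<open>b\<close>.\<close>

definition halves :: "real \<Rightarrow> real \<Rightarrow> real \<Rightarrow> real \<Rightarrow> bool" where
  "halves b a b' c \<longleftrightarrow> 0 < b' \<and> b' < b \<and> W a 0 0 = W 0 b' 0 \<and> W 0 0 c = W 0 b' 0 \<and> W 0 b' c = W 0 b 0"

lemma halves_compose:
  assumes "halves b a b' c"
  shows "std_step (\<lambda>x y. W x y 0) b' O std_step (\<lambda>x y. W x y 0) b' = std_step (\<lambda>x y. W x y 0) b"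
proof -
  have b': "0 < b'" "b' < b" and bc: "W 0 0 c = W 0 b' 0" "W 0 b' c = W 0 b 0"
    using assms by (auto simp: halves_def)
  \<comment> \<open>The long stick is split into \<open>b'\<close> in the second and
    \<open>c\<close> in the third coordinate; the first half is converted into the move from
    \<open>x\<close> to \<open>x1\<close> while \<open>c\<close> is kept aside, and then
    \<open>c\<close> is converted back into \<open>b'\<close>.\<close>
  have *: "W x b 0 = W x1 b' 0" if "W x1 0 0 = W x b' 0" for x x1
  proof -
    have "W x b 0 = W x b' c" using indep1_eq[OF bc(2)] by simp
    also have "\<dots> = W x1 0 c" using indep3_eq[OF that] by simp
    also have "\<dots> = W x1 b' 0" using indep1_eq[OF bc(1)] .
    finally show ?thesis .
  qed
  \<comment> \<open>A long step that exists passes over a midpoint: \<open>b' < b\<close> puts the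
    required value between two attained ones.\<close>
  have "\<exists>x1. W x1 0 0 = W x b' 0" if "W x2 0 0 = W x b 0" for x x2
  proof -
    have "W x 0 0 \<le> W x b' 0" "W x b' 0 \<le> W x2 0 0" using b' that by (simp_all add: le_iff)
    then show ?thesis using solve1 by blast
  qed
  then show ?thesis using * by (fastforce simp: std_step_def)
qed

lemma exists_halves:
  assumes "0 < b" "W a 0 0 = W 0 b 0" "W 0 0 c = W 0 b 0"
  shows "\<exists>a' b' c'. halves b a' b' c'"
proof -
  \<comment> \<open>\<open>g\<close> inverts the scale \<open>f\<close> of the second coordinate, so
    \<open>g (W 0 0 z)\<close> is the second coordinate that is worth as much as \<open>z\<close> in
    the third. Injectivity on a compact interval makes the inverse continuous.\<close>
  define f where "f t = W 0 t 0" for t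
  define g where "g = inv_into {0..b} f"
  have inj: "inj_on f {0..b}" unfolding f_def by (auto intro!: inj_onI simp: eq_iff)
  have cf: "continuous_on {0..b} f" unfolding f_def by (intro continuous_intros)
  have cg: "continuous_on (f ` {0..b}) g"
    by (rule continuous_on_inv[OF cf]) (auto simp: g_def inv_into_f_f[OF inj])
  have c: "0 < c" using assms(1,3) less_iff(3)[of 0 0 0 c] less_iff(2)[of 0 0 0 b] by simp
  have im: "W 0 0 z \<in> f ` {0..b}" if "z \<in> {0..c}" for z
  proof -
    have "W 0 0 0 \<le> W 0 0 z" "W 0 0 z \<le> W 0 b 0" using that by (simp_all add: le_iff assms(3)[symmetric])
    then show ?thesis using solve2[of 0 0 0 "W 0 0 z" b] by (force simp: f_def)
  qed
  have fg: "W 0 (g (W 0 0 z)) 0 = W 0 0 z" "g (W 0 0 z) \<in> {0..b}" if "z \<in> {0..c}" for z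
    using f_inv_into_f[OF im[OF that]] inv_into_into[OF im[OF that]] by (auto simp: f_def g_def)
  have "continuous_on {0..c} (\<lambda>z. g (W 0 0 z))"
    by (rule continuous_on_compose2[OF cg]) (use im in \<open>auto intro!: continuous_intros\<close>)
  then have ch: "continuous_on {0..c} (\<lambda>z. W 0 (g (W 0 0 z)) z)" by (intro continuous_intros)
  have g0: "g (W 0 0 0) = 0" using fg(1)[of 0] c by (simp add: eq_iff)
  have gc: "g (W 0 0 c) = b" using fg(1)[of c] c assms(3) by (simp add: eq_iff)
  \<comment> \<open>Using \<open>z\<close> and its equivalent together gives the value of
    \<open>0\<close> at \<open>z = 0\<close> and exceeds that of \<open>b\<close> at
    \<open>z = c\<close>. In between, the combination is worth exactly \<open>b\<close>, and its
    parts are the two halves.\<close>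
  have "W 0 (g (W 0 0 0)) 0 \<le> W 0 b 0" "W 0 b 0 \<le> W 0 (g (W 0 0 c)) c"
    unfolding g0 gc using assms(1) c by (simp_all add: le_iff)
  then obtain z where z: "0 \<le> z" "z \<le> c" "W 0 (g (W 0 0 z)) z = W 0 b 0"
    using IVT'[of "\<lambda>z. W 0 (g (W 0 0 z)) z" 0 "W 0 b 0" c] ch c by auto
  define b' where "b' = g (W 0 0 z)"
  have b': "W 0 b' 0 = W 0 0 z" "0 \<le> b'" "b' \<le> b" using fg[of z] z by (auto simp: b'_def)
  have z0: "z \<noteq> 0" using z(3) assms(1) g0 by (auto simp: eq_iff)
  have "0 < b'" using b' z0 z(1) less_iff(2)[of 0 0 0 b'] less_iff(3)[of 0 0 0 z] by auto
  moreover have "b' < b" using z(3) z0 z(1) less_iff(2)[of 0 b' 0 b] less_iff(3)[of 0 b' 0 z] by (simp add: b'_def)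
  moreover have "W 0 0 0 \<le> W 0 b' 0" "W 0 b' 0 \<le> W a 0 0" using b'(2,3) unfolding assms(2) by (simp_all add: le_iff)
  then obtain a' where "W a' 0 0 = W 0 b' 0" using solve1 by blast
  ultimately have "halves b a' b' z" using z(3) b'(1) unfolding halves_def b'_def by simp
  then show ?thesis by blast
qed

lemma exists_sticks:
  "\<exists>a b c. (\<forall>k. halves (b k) (a k) (b (Suc k)) (c k)) \<and> (\<forall>k. 0 < b k) \<and> b \<longlonglongrightarrow> (0::real)"
proof -
  \<comment> \<open>\<open>P\<close> records that one stick size is available in all three
    coordinates. \<open>exists_halves\<close> requires this, and \<open>halves\<close> reproduces it
    for the next level.\<close>
  define P where "P q \<longleftrightarrow> (case q of (a, b, c) \<Rightarrow> 0 < b \<and> W a 0 0 = W 0 b 0 \<and> W 0 0 c = W 0 b 0)" for q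
  define Q where "Q q q' \<longleftrightarrow> (case (q, q') of ((a, b, c), (a', b', c')) \<Rightarrow> halves b a' b' c')"
    for q q' :: "real \<times> real \<times> real"
  \<comment> \<open>A value above \<open>W 0 0 0\<close> that every coordinate reaches while the
    other two stay at \<open>0\<close>; it fixes the initial stick.\<close>
  define t where "t = min (W 1 0 0) (min (W 0 1 0) (W 0 0 1))"
  have t: "W 0 0 0 < t" "t \<le> W 1 0 0" "t \<le> W 0 1 0" "t \<le> W 0 0 1"
    unfolding t_def by (auto simp: less_iff)
  obtain a0 where a0: "W a0 0 0 = t" using solve1[of 0 0 0 t 1] t by auto
  obtain b0 where b0: "0 \<le> b0" "W 0 b0 0 = t" using solve2[of 0 0 0 t 1] t by auto
  obtain c0 where c0: "W 0 0 c0 = t" using solve3[of 0 0 0 t 1] t by auto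
  have "b0 \<noteq> 0" using b0 t by auto
  then have P0: "P (a0, b0, c0)" using a0 b0 c0 by (simp add: P_def)
  have "\<exists>f. \<forall>n. P (f n) \<and> Q (f n) (f (Suc n))"
  proof (rule dependent_nat_choice)
    show "\<exists>q. P q" using P0 by blast
    show "\<exists>q'. P q' \<and> Q q q'" if Pq: "P q" for q n
    proof -
      obtain a b c where q: "q = (a, b, c)" by (cases q)
      then obtain a' b' c' where "halves b a' b' c'" using exists_halves[of b a c] Pq unfolding P_def by auto
      then show ?thesis by (intro exI[of _ "(a', b', c')"]) (auto simp: P_def Q_def q halves_def)
    qed
  qed
  then obtain f where f: "\<And>n. P (f n)" "\<And>n. Q (f n) (f (Suc n))" by blast
  \<comment> \<open>\<open>a\<close> and \<open>c\<close> are shifted by one against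
    \<open>b\<close>, because the matches recorded by \<open>halves (b k)\<close> belong to the
    shorter stick \<open>b (Suc k)\<close>.\<close>
  define a where "a k = fst (f (Suc k))" for k
  define b where "b k = fst (snd (f k))" for k
  define c where "c k = snd (snd (f (Suc k)))" for k
  have h: "halves (b k) (a k) (b (Suc k)) (c k)" for k
    using f(2)[of k] unfolding Q_def a_def b_def c_def case_prod_beta fst_conv snd_conv .
  note hd = h[unfolded halves_def]
  have hb: "b (Suc k) < b k" for k using hd[of k] by (elim conjE)
  have hc: "W 0 0 (c k) = W 0 (b (Suc k)) 0" for k using hd[of k] by (elim conjE)
  have hbc: "W 0 (b (Suc k)) (c k) = W 0 (b k) 0" for k using hd[of k] by (elim conjE)
  have pos: "0 < b k" for k using f(1)[of k] unfolding P_def b_def case_prod_beta by blast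
  have cpos: "0 < c k" for k
  proof -
    have "W 0 0 0 < W 0 (b (Suc k)) 0" using pos by (simp add: less_iff)
    also have "\<dots> = W 0 0 (c k)" by (rule hc[symmetric])
    finally show ?thesis by (simp add: less_iff)
  qed
  have bd: "decseq b" by (intro decseq_SucI less_imp_le hb)
  have cd: "decseq c"
  proof (intro decseq_SucI)
    fix k
    have "W 0 0 (c (Suc k)) < W 0 0 (c k)" unfolding hc less_iff by (rule hb)
    then show "c (Suc k) \<le> c k" by (simp add: less_iff)
  qed
  obtain B where B: "b \<longlonglongrightarrow> B" using decseq_convergent[OF bd, of 0] pos less_imp_le by metis
  obtain C where C: "c \<longlonglongrightarrow> C" using decseq_convergent[OF cd, of 0] cpos less_imp_le by metis
  have B': "(\<lambda>k. b (Suc k)) \<longlonglongrightarrow> B" using B by (rule LIMSEQ_Suc)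
  \<comment> \<open>In the limit, two halves worth as much as the whole force \<open>C = 0\<close>;
    the match between \<open>c k\<close> and \<open>b (Suc k)\<close> then forces
    \<open>B = 0\<close>.\<close>
  have "(\<lambda>k. W 0 (b (Suc k)) (c k)) \<longlonglongrightarrow> W 0 B C" by (intro cont tendsto_const B' C)
  moreover have "(\<lambda>k. W 0 (b (Suc k)) (c k)) \<longlonglongrightarrow> W 0 B 0"
    unfolding hbc by (intro cont tendsto_const B)
  ultimately have "W 0 B C = W 0 B 0" by (rule LIMSEQ_unique)
  then have C0: "C = 0" by (simp add: eq_iff)
  have "(\<lambda>k. W 0 0 (c k)) \<longlonglongrightarrow> W 0 0 0" using cont[OF tendsto_const tendsto_const C] C0 by simp
  from this[unfolded hc] have "W 0 0 0 = W 0 B 0"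
    by (rule LIMSEQ_unique) (intro cont tendsto_const B')
  then have "B = 0" by (simp add: eq_iff)
  then have "b \<longlonglongrightarrow> 0" using B by simp
  with h pos show ?thesis by (intro exI conjI allI)
qed

text \<open>The gain from \<open>x\<close> to \<open>x1\<close> outweighs the loss from
  \<open>z\<close> to \<open>z1\<close>, so a chain inside \<open>[z1, z]\<close> can be copied into
  \<open>[x, x1]\<close>. The copy is steered by the invariant \<open>W xn 0 z1 = W x 0 zn\<close>,
  which says that both chains have gained the same amount.\<close>

lemma step_count_le:
  assumes b: "0 < b" and x: "x \<le> x1" and z: "z1 \<le> z" and w: "W x 0 z \<le> W x1 0 z1"
  shows "step_count (\<lambda>z y. W 0 y z) b z1 z \<le> step_count (\<lambda>x y. W x y 0) b x x1"
proof -
  interpret A: bimonotone "\<lambda>x y. W x y 0" by unfold_locales (auto simp: less_iff intro!: continuous_intros)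
  interpret C: bimonotone "\<lambda>z y. W 0 y z" by unfold_locales (auto simp: less_iff intro!: continuous_intros)
  have *: "\<exists>xn. (x, xn) \<in> std_step (\<lambda>x y. W x y 0) b ^^ n \<and> W xn 0 z1 = W x 0 zn"
    if "(z1, zn) \<in> std_step (\<lambda>z y. W 0 y z) b ^^ n" "zn \<le> z" for n zn
    using that
  proof (induction n arbitrary: zn)
    case 0 then show ?case by auto
  next
    case (Suc n)
    then obtain zm where zm: "(z1, zm) \<in> std_step (\<lambda>z y. W 0 y z) b ^^ n" "(zm, zn) \<in> std_step (\<lambda>z y. W 0 y z) b"
      by auto
    have "zm < zn" using C.step_gt[OF b zm(2)] .
    then obtain xm where xm: "(x, xm) \<in> std_step (\<lambda>x y. W x y 0) b ^^ n" "W xm 0 z1 = W x 0 zm"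
      using Suc.IH[OF zm(1)] Suc.prems(2) by auto
    have s: "W 0 0 zn = W 0 b zm" using zm(2) by (simp add: std_step_def)
    have "W x 0 z1 \<le> W x 0 zn" "W x 0 zn \<le> W x1 0 z1"
      using C.steps_ge[OF b Suc.prems(1)] Suc.prems(2) w le_iff(3)[of x 0 z1 zn] le_iff(3)[of x 0 zn z] by auto
    then obtain xn where xn: "W xn 0 z1 = W x 0 zn" using solve1 by blast
    have "W xn 0 z1 = W x b zm" using xn indep1_eq[OF s, of x] by simp
    also have "\<dots> = W xm b z1" using indep2_eq[OF xm(2), of b] by simp
    finally have "W xn 0 0 = W xm b 0" by (rule indep3_eq)
    then show ?case using xm(1) xn by (auto simp: std_step_def)
  qed
  have "step_count (\<lambda>z y. W 0 y z) b z1 z \<in> step_counts (\<lambda>z y. W 0 y z) b z1 z"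
    using C.le_step_count_iff[OF b z] by blast
  then obtain zn where zn: "zn \<le> z" "(z1, zn) \<in> std_step (\<lambda>z y. W 0 y z) b ^^ step_count (\<lambda>z y. W 0 y z) b z1 z"
    by (auto simp: step_counts_def)
  obtain xn where xn: "(x, xn) \<in> std_step (\<lambda>x y. W x y 0) b ^^ step_count (\<lambda>z y. W 0 y z) b z1 z"
    "W xn 0 z1 = W x 0 zn" using *[OF zn(2,1)] by blast
  have "W x 0 zn \<le> W x 0 z" using zn(1) le_iff(3) by blast
  then have "W xn 0 z1 \<le> W x1 0 z1" using w xn(2) by simp
  then have "xn \<le> x1" using le_iff(1) by blast
  then show ?thesis using xn(1) A.le_step_count_iff[OF b x] by (auto simp: step_counts_def)
qed

end

section \<open>Additive utilities from matched counts\<close>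

definition additive_rep ::
    "(real \<Rightarrow> real \<Rightarrow> real \<Rightarrow> real) \<Rightarrow> (real \<Rightarrow> real) \<Rightarrow> (real \<Rightarrow> real) \<Rightarrow> (real \<Rightarrow> real) \<Rightarrow> bool" where
  "additive_rep W u v w \<longleftrightarrow>
     continuous_on UNIV u \<and> continuous_on UNIV v \<and> continuous_on UNIV w \<and>
     (\<forall>x y z x' y' z'. W x y z \<le> W x' y' z' \<longleftrightarrow> u x + v y + w z \<le> u x' + v y' + w z')"

context independent3
begin

lemma indep1_iff: "W x y z \<le> W x y' z' \<longleftrightarrow> W t y z \<le> W t y' z'"
  and indep2_iff: "W x y z \<le> W x' y z' \<longleftrightarrow> W x t z \<le> W x' t z'"
  and indep3_iff: "W x y z \<le> W x' y' z \<longleftrightarrow> W x y t \<le> W x' y' t"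
  by (rule iffI; rule indep1 indep2 indep3; assumption)+

text \<open>Both utilities are lengths measured with the same sticks of the second coordinate.
  Comparing counts in this arrangement and in the one with first and third coordinate exchanged
  yields inequalities between lengths in both directions.\<close>

lemma two_component_rep:
  "\<exists>u w :: real \<Rightarrow> real. continuous_on UNIV u \<and> continuous_on UNIV w \<and>
     (\<forall>x y z x' z'. W x y z \<le> W x' y z' \<longleftrightarrow> u x + w z \<le> u x' + w z')"
proof -
  interpret S: independent3 "\<lambda>x y z. W z y x" by (rule swap13)
  obtain a b c where h: "\<And>k. halves (b k) (a k) (b (Suc k)) (c k)"
    and b: "\<And>k. 0 < b k" "b \<longlonglongrightarrow> (0::real)" using exists_sticks by blast
  \<comment> \<open>As \<open>a\<close> and \<open>c\<close> are equally good, \<open>b'\<close>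
    combined with \<open>a\<close> is worth the same as \<open>b'\<close> combined with
    \<open>c\<close>. Halving therefore also works with the first coordinate as the place to park a
    stick.\<close>
  have hS: "S.halves (b k) (c k) (b (Suc k)) (a k)" for k
    using h[of k] indep2_eq[of "a k" 0 0 0 "c k" "b (Suc k)"] unfolding halves_def S.halves_def by simp
  interpret A: stick_sequence "\<lambda>x y. W x y 0" b
    by unfold_locales (auto simp: less_iff b halves_compose[OF h] intro!: continuous_intros)
  interpret C: stick_sequence "\<lambda>z y. W 0 y z" b
    by unfold_locales (auto simp: less_iff b S.halves_compose[OF hS] intro!: continuous_intros)
  have le1: "C.len z1 z \<le> A.len x x1" if "x \<le> x1" "z1 \<le> z" "W x 0 z \<le> W x1 0 z1" for x x1 z z1
  proof (rule LIMSEQ_le[OF C.len_lim[OF that(2)] A.len_lim[OF that(1)]], intro exI[of _ 0] allI impI)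
    fix k show "C.apx z1 z k \<le> A.apx x x1 k"
      using step_count_le[OF b(1)[of k] that] unfolding A.apx_def C.apx_def by (simp add: divide_right_mono)
  qed
  have le2: "A.len x x1 \<le> C.len z1 z" if "x \<le> x1" "z1 \<le> z" "W x1 0 z1 \<le> W x 0 z" for x x1 z z1
  proof (rule LIMSEQ_le[OF A.len_lim[OF that(1)] C.len_lim[OF that(2)]], intro exI[of _ 0] allI impI)
    fix k show "A.apx x x1 k \<le> C.apx z1 z k"
      using S.step_count_le[OF b(1)[of k] that(2,1,3)] unfolding A.apx_def C.apx_def by (simp add: divide_right_mono)
  qed
  have A_mono: "A.val x \<le> A.val x1" if "x \<le> x1" for x x1
    using A.val_less[of x x1] that by (cases "x = x1") auto
  have C_mono: "C.val x \<le> C.val x1" if "x \<le> x1" for x x1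
    using C.val_less[of x x1] that by (cases "x = x1") auto
  have imp: "A.val x + C.val z \<le> A.val x1 + C.val z1" if w: "W x 0 z \<le> W x1 0 z1" for x x1 z z1
  proof (cases "x \<le> x1")
    case True
    show ?thesis
    proof (cases "z \<le> z1")
      case True then show ?thesis using A_mono[OF \<open>x \<le> x1\<close>] C_mono[OF True] by simp
    next
      case False
      then show ?thesis using le1[OF True _ w] A.val_diff[OF True] C.val_diff[of z1 z] by simp
    qed
  next
    case False
    have "z \<le> z1"
    proof (rule ccontr)
      assume "\<not> z \<le> z1"
      then have "W x1 0 z1 < W x1 0 z" "W x1 0 z < W x 0 z" using False by (simp_all add: less_iff)
      then show False using w by simp
    qed
    then show ?thesis using le2[of x1 x z z1] w False A.val_diff[of x1 x] C.val_diff[of z z1] by simp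
  qed
  \<comment> \<open>A strict comparison leaves room to raise \<open>x\<close> a little while keeping
    the weak one, and \<open>A.val\<close> is strictly increasing.\<close>
  have strict: "A.val x + C.val z < A.val x1 + C.val z1" if w: "W x 0 z < W x1 0 z1" for x x1 z z1
  proof -
    have "\<exists>x2>x. W x2 0 z \<le> W x1 0 z1"
    proof (cases "W (x + 1) 0 z \<le> W x1 0 z1")
      case True then show ?thesis by (intro exI[of _ "x + 1"]) simp
    next
      case False
      then obtain x2 where x2: "x \<le> x2" "W x2 0 z = W x1 0 z1"
        using solve1[of x 0 z "W x1 0 z1" "x + 1"] w by auto
      moreover have "x2 \<noteq> x" using x2 w by auto
      ultimately show ?thesis by (intro exI[of _ x2]) simp
    qed
    then obtain x2 where "x < x2" "W x2 0 z \<le> W x1 0 z1" by blast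
    then show ?thesis using imp[of x2 z x1 z1] A.val_less[of x x2] by simp
  qed
  have "W x y z \<le> W x' y z' \<longleftrightarrow> A.val x + C.val z \<le> A.val x' + C.val z'" for x y z x' z'
  proof -
    have "W x y z \<le> W x' y z' \<longleftrightarrow> W x 0 z \<le> W x' 0 z'" by (rule indep2_iff)
    then show ?thesis using imp[of x z x' z'] strict[of x' z' x z] by linarith
  qed
  then show ?thesis using A.val_cont C.val_cont by blast
qed

text \<open>If the second coordinate has the smallest range, each of its steps can be matched by a single
  step in either of the other coordinates, which transports their utilities to it.\<close>

lemma dominated_rep:
  assumes dom1: "\<And>y y'. y < y' \<Longrightarrow> \<exists>x x'. W x' y 0 = W x y' 0"
    and dom3: "\<And>y y'. y < y' \<Longrightarrow> \<exists>z z'. W 0 y z' = W 0 y' z"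
  shows "\<exists>u v w. additive_rep W u v w"
proof -
  obtain u w :: "real \<Rightarrow> real" where uc: "continuous_on UNIV u" and wc: "continuous_on UNIV w"
    and AC: "\<And>x y z x' z'. W x y z \<le> W x' y z' \<longleftrightarrow> u x + w z \<le> u x' + w z'"
    using two_component_rep by blast
  have ACeq: "u x + w z = u x' + w z'" if "W x y z = W x' y z'" for x y z x' z'
    using AC[of x y z x' z'] AC[of x' y z' x z] that by linarith
  have u_less: "u x < u x'" if "x < x'" for x x'
    using AC[of x' 0 0 x 0] that by (simp add: le_iff)
  have w_less: "w x < w x'" if "x < x'" for x x'
    using AC[of 0 0 x' 0 x] that by (simp add: le_iff)
  have ex1: "\<exists>x x'. W x' y 0 = W x y' 0" if "y \<le> y'" for y y'
    using dom1[of y y'] that by (cases "y = y'") auto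
  have ex3: "\<exists>z z'. W 0 y z' = W 0 y' z" if "y \<le> y'" for y y'
    using dom3[of y y'] that by (cases "y = y'") auto
  have match: "u x' - u x = w z' - w z" if "W x' y 0 = W x y' 0" "W 0 y z' = W 0 y' z" for x x' y y' z z'
  proof -
    have "W x y z' = W x y' z" using indep1_eq[OF that(2)] .
    also have "\<dots> = W x' y z" using indep3_eq[OF that(1)] by simp
    finally show ?thesis using ACeq by fastforce
  qed
  \<comment> \<open>The length of a step in the second coordinate, read off from any matching step
    in the first. By \<open>match\<close> it equals the length of any matching step in the third, so
    the choice does not matter.\<close>
  define d where "d y y' = (SOME r. \<exists>x x'. W x' y 0 = W x y' 0 \<and> r = u x' - u x)" for y y'
  have d1: "d y y' = u x' - u x" if "y \<le> y'" "W x' y 0 = W x y' 0" for x x' y y'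
  proof -
    obtain z z' where z: "W 0 y z' = W 0 y' z" using ex3[OF \<open>y \<le> y'\<close>] by blast
    show ?thesis unfolding d_def
    proof (rule some_equality)
      show "\<exists>a a'. W a' y 0 = W a y' 0 \<and> u x' - u x = u a' - u a" using that(2) by blast
      fix r assume "\<exists>a a'. W a' y 0 = W a y' 0 \<and> r = u a' - u a"
      then show "r = u x' - u x" using match[OF _ z] that(2) by auto
    qed
  qed
  have d3: "d y y' = w z' - w z" if "y \<le> y'" "W 0 y z' = W 0 y' z" for z z' y y'
    using ex1[OF that(1)] match[OF _ that(2)] d1[OF that(1)] by auto
  have d_add: "d y y'' = d y y' + d y' y''" if y: "y \<le> y'" "y' \<le> y''" for y y' y''
  proof -
    have yy: "y \<le> y''" using y by simp
    obtain z z'' where z: "W 0 y z'' = W 0 y'' z" using ex3[OF yy] by blast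
    have "W 0 y z \<le> W 0 y' z" "W 0 y' z \<le> W 0 y z''" using y unfolding z by (simp_all add: le_iff)
    then obtain z1 where z1: "W 0 y z1 = W 0 y' z" using solve3 by blast
    obtain x x' where x: "W x' y' 0 = W x y'' 0" using ex1[OF y(2)] by blast
    \<comment> \<open>The whole step and its first part are measured in the third coordinate, the
      second part in the first coordinate; the two measurements meet in a comparison that involves
      \<open>u\<close> and \<open>w\<close> only.\<close>
    have "W x y z'' = W x y'' z" using indep1_eq[OF z] .
    also have "\<dots> = W x' y' z" using indep3_eq[OF x] by simp
    also have "\<dots> = W x' y z1" using indep1_eq[OF z1] by simp
    finally have "u x + w z'' = u x' + w z1" by (rule ACeq)
    then show ?thesis using d3[OF yy z] d3[OF y(1) z1] d1[OF y(2) x] by simp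
  qed
  define v where "v = potential d"
  have vd: "v y' - v y = d y y'" if "y \<le> y'" for y y'
    unfolding v_def using d_add that by (rule potential_diff)
  have AB: "W x y z \<le> W x1 y1 z \<longleftrightarrow> u x + v y \<le> u x1 + v y1" for x y z x1 y1
  proof (cases "y \<le> y1")
    case True
    \<comment> \<open>By independence the common third coordinate \<open>z\<close> may be replaced
      by a level \<open>c\<close> at which the change from \<open>y\<close> to \<open>y1\<close> can
      be traded.\<close>
    obtain c c' where c: "W 0 y c' = W 0 y1 c" using ex3[OF True] by blast
    have "W x y z \<le> W x1 y1 z \<longleftrightarrow> W x y c \<le> W x1 y1 c" by (rule indep3_iff)
    also have "W x1 y1 c = W x1 y c'" using indep1_eq[OF c] by simp
    finally show ?thesis using AC[of x y c x1 c'] d3[OF True c] vd[OF True] by linarith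
  next
    case False
    then have le: "y1 \<le> y" by simp
    obtain c c' where c: "W 0 y1 c' = W 0 y c" using ex3[OF le] by blast
    have "W x y z \<le> W x1 y1 z \<longleftrightarrow> W x y c \<le> W x1 y1 c" by (rule indep3_iff)
    also have "W x y c = W x y1 c'" using indep1_eq[OF c] by simp
    finally show ?thesis using AC[of x y1 c' x1 c] d3[OF le c] vd[OF le] by linarith
  qed
  have BC: "W x y z \<le> W x y1 z1 \<longleftrightarrow> v y + w z \<le> v y1 + w z1" for x y z y1 z1
  proof (cases "y \<le> y1")
    case True
    obtain c c' where c: "W c' y 0 = W c y1 0" using ex1[OF True] by blast
    have "W x y z \<le> W x y1 z1 \<longleftrightarrow> W c y z \<le> W c y1 z1" by (rule indep1_iff)
    also have "W c y1 z1 = W c' y z1" using indep3_eq[OF c] by simp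
    finally show ?thesis using AC[of c y z c' z1] d1[OF True c] vd[OF True] by linarith
  next
    case False
    then have le: "y1 \<le> y" by simp
    obtain c c' where c: "W c' y1 0 = W c y 0" using ex1[OF le] by blast
    have "W x y z \<le> W x y1 z1 \<longleftrightarrow> W c y z \<le> W c y1 z1" by (rule indep1_iff)
    also have "W c y z = W c' y1 z" using indep3_eq[OF c] by simp
    finally show ?thesis using AC[of c' y1 z c z1] d1[OF le c] vd[OF le] by linarith
  qed
  have v_less: "v x < v x'" if "x < x'" for x x'
    using AB[of 0 x' 0 0 x] that by (simp add: le_iff)
  have vc: "continuous_on UNIV v"
    unfolding continuous_on_eq_continuous_at[OF open_UNIV] continuous_at
  proof (intro ballI tendstoI)
    fix y e :: real assume e: "0 < e"
    have cW: "((\<lambda>t. W x t 0) \<longlongrightarrow> W x y 0) (at y)" for x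
      using continuous_on_W[of UNIV "\<lambda>_. x" "\<lambda>t. t" "\<lambda>_. 0"]
      by (simp add: continuous_on_eq_continuous_at continuous_at)
    \<comment> \<open>Continuity of \<open>v\<close> is inherited from \<open>u\<close>: a change of
      the second coordinate too small to outweigh the move from \<open>0\<close> to \<open>x\<close>
      in the first has length below \<open>e\<close>.\<close>
    have "(u \<longlongrightarrow> u 0) (at_right 0)"
      using uc by (simp add: continuous_on_eq_continuous_at continuous_at filterlim_at_split)
    then have "\<forall>\<^sub>F x in at_right 0. u x < u 0 + e" using order_tendstoD(2) e by fastforce
    then obtain x where x: "0 < x" "u x < u 0 + e"
      unfolding eventually_at_right_field by (metis dense)
    have "\<forall>\<^sub>F t in at y. W 0 t 0 < W x y 0" using order_tendstoD(2)[OF cW] x by (simp add: less_iff)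
    moreover have "\<forall>\<^sub>F t in at y. W 0 y 0 < W x t 0" using order_tendstoD(1)[OF cW] x by (simp add: less_iff)
    ultimately show "\<forall>\<^sub>F t in at y. dist (v t) (v y) < e"
    proof eventually_elim
      case (elim t)
      then have "u 0 + v t < u x + v y" "u 0 + v y < u x + v t"
        using AB[of x y 0 0 t] AB[of x t 0 0 y] by linarith+
      then show ?case using x(2) by (simp add: dist_real_def)
    qed
  qed
  define S where "S x y z = u x + v y + w z" for x y z
  \<comment> \<open>If two coordinates change in opposite directions, trading one change against the other leaves a
    comparison of triples that agree in one coordinate.\<close>
  have main: "(W x y z \<le> W x1 y1 z1 \<longleftrightarrow> S x y z \<le> S x1 y1 z1) \<and> (W x1 y1 z1 \<le> W x y z \<longleftrightarrow> S x1 y1 z1 \<le> S x y z)"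
    if y: "y \<le> y1" for x y z x1 y1 z1
  proof -
    consider "x1 < x" | "z1 < z" | "x \<le> x1" "z \<le> z1" by linarith
    then show ?thesis
    proof cases
      case 1
      have 0: "W x1 y 0 \<le> W x1 y1 0" "W x1 y 0 \<le> W x y 0" using y 1 by (simp_all add: le_iff)
      show ?thesis
      proof (cases "W x1 y1 0 \<le> W x y 0")
        \<comment> \<open>The smaller of the two opposite changes is converted into the coordinate
          of the larger one, so that the intermediate value theorem supplies the equivalent. This
          leaves a common second coordinate here, and a common first coordinate in the other
          case.\<close>
        case True
        then obtain x2 where x2: "W x2 y 0 = W x1 y1 0" using solve1[OF 0(1)] by blast
        have "W x1 y1 z1 = W x2 y z1" using indep3_eq[OF x2] by simp
        moreover have "u x2 + v y = u x1 + v y1" using AB[of x2 y 0 x1 y1] AB[of x1 y1 0 x2 y] x2 by simp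
        ultimately show ?thesis using AC[of x y z x2 z1] AC[of x2 y z1 x z] unfolding S_def by (smt (verit))
      next
        case False
        then obtain y2 where y2: "W x1 y2 0 = W x y 0" using solve2[OF 0(2), of y1] by auto
        have "W x y z = W x1 y2 z" using indep3_eq[OF y2] by simp
        moreover have "u x1 + v y2 = u x + v y" using AB[of x1 y2 0 x y] AB[of x y 0 x1 y2] y2 by simp
        ultimately show ?thesis using BC[of x1 y2 z y1 z1] BC[of x1 y1 z1 y2 z] unfolding S_def
          by (smt (verit))
      qed
    next
      case 2
      have 0: "W 0 y z1 \<le> W 0 y1 z1" "W 0 y z1 \<le> W 0 y z" using y 2 by (simp_all add: le_iff)
      show ?thesis
      proof (cases "W 0 y1 z1 \<le> W 0 y z")
        case True
        then obtain z2 where z2: "W 0 y z2 = W 0 y1 z1" using solve3[OF 0(1)] by blast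
        have "W x1 y1 z1 = W x1 y z2" using indep1_eq[OF z2] by simp
        moreover have "v y + w z2 = v y1 + w z1" using BC[of 0 y z2 y1 z1] BC[of 0 y1 z1 y z2] z2 by simp
        ultimately show ?thesis using AC[of x y z x1 z2] AC[of x1 y z2 x z] unfolding S_def by (smt (verit))
      next
        case False
        then obtain y2 where y2: "W 0 y2 z1 = W 0 y z" using solve2[OF 0(2), of y1] by auto
        have "W x y z = W x y2 z1" using indep1_eq[OF y2] by simp
        moreover have "v y2 + w z1 = v y + w z" using BC[of 0 y2 z1 y z] BC[of 0 y z y2 z1] y2 by simp
        ultimately show ?thesis using AB[of x y2 z1 x1 y1] AB[of x1 y1 z1 x y2] unfolding S_def
          by (smt (verit))
      qed
    next
      case 3
      show ?thesis
      proof (cases "x = x1 \<and> y = y1 \<and> z = z1")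
        case False
        have leW: "W x y z \<le> W x1 y z" "W x1 y z \<le> W x1 y1 z" "W x1 y1 z \<le> W x1 y1 z1"
          using y 3 by (simp_all add: le_iff)
        have leS: "u x \<le> u x1" "v y \<le> v y1" "w z \<le> w z1"
          using y 3 u_less[of x x1] v_less[of y y1] w_less[of z z1]
          by (auto simp: order_le_less)
        have "x < x1 \<or> y < y1 \<or> z < z1" using False y 3 by auto
        then have "W x y z < W x1 y z \<and> u x < u x1 \<or> W x1 y z < W x1 y1 z \<and> v y < v y1
            \<or> W x1 y1 z < W x1 y1 z1 \<and> w z < w z1"
          using u_less v_less w_less unfolding less_iff by blast
        then have "W x y z < W x1 y1 z1" "S x y z < S x1 y1 z1"
          using leW leS unfolding S_def by linarith+
        then show ?thesis by simp
      qed simp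
    qed
  qed
  have "W x y z \<le> W x1 y1 z1 \<longleftrightarrow> S x y z \<le> S x1 y1 z1" for x y z x1 y1 z1
    using main[of y y1 x z x1 z1] main[of y1 y x1 z1 x z] linear[of y y1] by blast
  then show ?thesis unfolding additive_rep_def S_def using uc vc wc by blast
qed

text \<open>A comparison of the ranges of two coordinate utilities that makes sense before the
  utilities are available: every change in the second coordinate fits into the first as a single
  step.\<close>

definition "dominates12 \<longleftrightarrow> (\<forall>y y'. y < y' \<longrightarrow> (\<exists>x x'. W x' y 0 = W x y' 0))"

text \<open>An interval \<open>[y, y']\<close> that no step of the first coordinate matches must
  exceed all of them, by the intermediate value theorem; hence each step of the first coordinate
  fits inside it.\<close>

lemma dominates12_total:
  assumes "\<not> dominates12"
  shows "independent3.dominates12 (\<lambda>x y z. W y x z)"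
proof -
  interpret S: independent3 "\<lambda>x y z. W y x z" by (rule swap12)
  obtain y y' where y: "y < y'" and no: "\<And>x x'. W x' y 0 \<noteq> W x y' 0"
    using assms unfolding dominates12_def by blast
  have "\<exists>t t'. W x t' 0 = W x' t 0" if x: "x < x'" for x x'
  proof -
    have "W x' y 0 < W x y' 0"
    proof (rule ccontr)
      assume n: "\<not> W x' y 0 < W x y' 0"
      then have "W x y 0 \<le> W x y' 0" "W x y' 0 \<le> W x' y 0" using y by (simp_all add: le_iff)
      then show False using solve1 no by blast
    qed
    moreover have "W x y 0 \<le> W x' y 0" using x by (simp add: le_iff)
    ultimately show ?thesis using solve2[of x y 0 "W x' y 0" y'] by auto
  qed
  then show ?thesis unfolding S.dominates12_def by blast
qed

lemma dominates12_trans: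
  assumes "dominates12" "independent3.dominates12 (\<lambda>x y z. W z x y)"
  shows "independent3.dominates12 (\<lambda>x y z. W x z y)"
proof -
  interpret S: independent3 "\<lambda>x y z. W x z y" by (rule swap23)
  interpret T: independent3 "\<lambda>x y z. W z x y" by (rule independent3.swap23[OF swap12])
  have "\<exists>x x'. W x' 0 z = W x 0 z'" if z: "z < z'" for z z'
  proof -
    obtain y y' where y: "W 0 y' z = W 0 y z'" using assms(2) z unfolding T.dominates12_def by blast
    have "W 0 y z < W 0 y' z" using z unfolding y by (simp add: less_iff)
    then have "y < y'" by (simp add: less_iff)
    then obtain x x' where x: "W x' y 0 = W x y' 0" using assms(1) unfolding dominates12_def by blast
    have "W x' y z = W x y' z" using indep3_eq[OF x] .
    also have "\<dots> = W x y z'" using indep1_eq[OF y] .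
    finally show ?thesis using indep2_eq by blast
  qed
  then show ?thesis unfolding S.dominates12_def by blast
qed

theorem additive_rep_exists: "\<exists>u v w. additive_rep W u v w"
proof -
  \<comment> \<open>The six arrangements encode domination for the six ordered pairs of coordinates.
    Totality and transitivity produce a coordinate dominated by the other two, which is then moved
    to the middle position.\<close>
  interpret S: independent3 "\<lambda>x y z. W y x z" by (rule swap12)
  interpret T: independent3 "\<lambda>x y z. W x z y" by (rule swap23)
  interpret U: independent3 "\<lambda>x y z. W z x y" by (rule independent3.swap23[OF swap12])
  interpret V: independent3 "\<lambda>x y z. W z y x" by (rule swap13)
  interpret X: independent3 "\<lambda>x y z. W y z x" by (rule independent3.swap12[OF swap23])
  have "dominates12 \<or> S.dominates12" "T.dominates12 \<or> X.dominates12" "U.dominates12 \<or> V.dominates12"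
    using dominates12_total T.dominates12_total U.dominates12_total by blast+
  moreover have "dominates12 \<Longrightarrow> U.dominates12 \<Longrightarrow> T.dominates12" "S.dominates12 \<Longrightarrow> T.dominates12 \<Longrightarrow> U.dominates12"
    using dominates12_trans S.dominates12_trans by blast+
  ultimately consider "dominates12" "V.dominates12" | "S.dominates12" "X.dominates12" | "T.dominates12" "U.dominates12"
    by blast
  then show ?thesis
  proof cases
    case 1
    then show ?thesis using dominated_rep unfolding dominates12_def V.dominates12_def by blast
  next
    case 2
    then obtain u v w where "additive_rep (\<lambda>x y z. W y x z) u v w"
      using S.dominated_rep unfolding S.dominates12_def X.dominates12_def by blast
    then have "additive_rep W v u w" unfolding additive_rep_def by (auto simp: add_ac)
    then show ?thesis by blast
  next
    case 3
    then obtain u v w where "additive_rep (\<lambda>x y z. W x z y) u v w"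
      using T.dominated_rep unfolding T.dominates12_def U.dominates12_def by blast
    then have "additive_rep W u w v" unfolding additive_rep_def by (auto simp: add_ac)
    then show ?thesis by blast
  qed
qed

end

section \<open>Certainty equivalents\<close>

lemma Linf_const [simp]: "(\<lambda>_. c) \<in> Linf M"
  by (simp add: Linf_def)

lemma Linf_mix [simp]:
  assumes "A \<in> sets M" "f \<in> Linf M" "g \<in> Linf M"
  shows "mix A f g \<in> Linf M"
proof -
  have "range (mix A f g) \<subseteq> range f \<union> range g" by (auto simp: mix_def)
  then have "bounded (range (mix A f g))" 
    using assms by (auto simp: Linf_def intro: bounded_subset[OF bounded_Un[THEN iffD2]])
  moreover have "mix A f g \<in> borel_measurable M"
    unfolding mix_def using assms by (intro measurable_If_set) (auto simp: Linf_def intro: sets.Int)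
  ultimately show ?thesis by (simp add: Linf_def)
qed

lemma Linf_bound: "f \<in> Linf M \<Longrightarrow> \<exists>B>0. \<forall>\<omega>. \<bar>f \<omega>\<bar> \<le> B"
  unfolding Linf_def bounded_pos by auto

lemma LinfI: "f \<in> borel_measurable M \<Longrightarrow> (\<And>\<omega>. \<bar>f \<omega>\<bar> \<le> B) \<Longrightarrow> f \<in> Linf M"
  unfolding Linf_def bounded_iff by auto

section \<open>Dyadic approximation of bounded acts from below\<close>

definition dyadic_floor :: "nat \<Rightarrow> real \<Rightarrow> real" where
  "dyadic_floor k x = \<lfloor>x * 2 ^ k\<rfloor> / 2 ^ k"

lemma dyadic_floor_le: "dyadic_floor k x \<le> x"
  unfolding dyadic_floor_def by (simp add: divide_le_eq)

lemma dyadic_floor_gt: "x < dyadic_floor k x + 1 / 2 ^ k"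
proof -
  have "x * 2 ^ k < of_int \<lfloor>x * 2 ^ k\<rfloor> + 1" by linarith
  then show ?thesis unfolding dyadic_floor_def by (simp add: field_simps)
qed

lemma dyadic_floor_lim: "(\<lambda>k. dyadic_floor k x) \<longlonglongrightarrow> x"
proof (rule tendsto_sandwich)
  show "\<forall>\<^sub>F k in sequentially. x - 1 / 2 ^ k \<le> dyadic_floor k x"
    using dyadic_floor_gt[of x] by (intro always_eventually allI) (simp add: diff_le_eq less_imp_le)
  show "\<forall>\<^sub>F k in sequentially. dyadic_floor k x \<le> x" using dyadic_floor_le by simp
  show "(\<lambda>k. x - 1 / 2 ^ k) \<longlonglongrightarrow> x" using tendsto_diff[OF tendsto_const inverse_power2_lim] by simp
qed simp

lemma dyadic_floor_abs: "\<bar>dyadic_floor k x\<bar> \<le> \<bar>x\<bar> + 1"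
proof -
  have "1 / 2 ^ k \<le> (1::real)" by simp
  then show ?thesis using dyadic_floor_le[of k x] dyadic_floor_gt[of x k] by linarith
qed

lemma dyadic_floor_Linf:
  assumes "f \<in> Linf M"
  shows "(\<lambda>\<omega>. dyadic_floor k (f \<omega>)) \<in> Linf M" and "finite (range (\<lambda>\<omega>. dyadic_floor k (f \<omega>)))"
proof -
  obtain B where B: "\<And>\<omega>. \<bar>f \<omega>\<bar> \<le> B" using Linf_bound[OF assms] by auto
  have [measurable]: "f \<in> borel_measurable M" using assms by (simp add: Linf_def)
  have "\<bar>dyadic_floor k (f \<omega>)\<bar> \<le> B + 1" for \<omega> using dyadic_floor_abs[of k "f \<omega>"] B[of \<omega>] by linarith
  then show "(\<lambda>\<omega>. dyadic_floor k (f \<omega>)) \<in> Linf M"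
    by (intro LinfI[of _ _ "B + 1"]) (auto simp: dyadic_floor_def)
  have "range (\<lambda>\<omega>. dyadic_floor k (f \<omega>)) \<subseteq> (\<lambda>j. real_of_int j / 2 ^ k) ` {\<lfloor>- B * 2 ^ k\<rfloor>..\<lfloor>B * 2 ^ k\<rfloor>}"
  proof
    fix y assume "y \<in> range (\<lambda>\<omega>. dyadic_floor k (f \<omega>))"
    then obtain \<omega> where y: "y = dyadic_floor k (f \<omega>)" by auto
    have "- B \<le> f \<omega>" "f \<omega> \<le> B" using B[of \<omega>] by auto
    then have "- B * 2 ^ k \<le> f \<omega> * 2 ^ k" "f \<omega> * 2 ^ k \<le> B * 2 ^ k" by (intro mult_right_mono; simp)+
    then show "y \<in> (\<lambda>j. real_of_int j / 2 ^ k) ` {\<lfloor>- B * 2 ^ k\<rfloor>..\<lfloor>B * 2 ^ k\<rfloor>}"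
      unfolding y dyadic_floor_def using floor_mono by (intro imageI) auto
  qed
  then show "finite (range (\<lambda>\<omega>. dyadic_floor k (f \<omega>)))" by (rule finite_subset) simp
qed

lemma null_events_subset:
  assumes "B \<in> null_events M R" "A \<in> sets M" "A \<subseteq> B"
  shows "A \<in> null_events M R"
proof -
  have "indiff R (mix A f g) g" if "f \<in> Linf M" "g \<in> Linf M" for f g
  proof -
    have "mix A f g = mix B (mix A f g) g" using assms(3) by (auto simp: mix_def fun_eq_iff)
    moreover have "indiff R (mix B (mix A f g) g) g"
      using assms(1) that Linf_mix[OF assms(2) that] unfolding null_events_def by blast
    ultimately show ?thesis by simp
  qed
  then show ?thesis using assms unfolding null_events_def by blast
qed

locale preference =
  fixes M :: "'a measure" and R :: "('a \<Rightarrow> real) \<Rightarrow> ('a \<Rightarrow> real) \<Rightarrow> bool"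
  assumes space_M: "space M = UNIV"
    and pref_order: "pref_order M R"
    and SM: "SM M R" and PC: "PC M R" and ST: "ST M R"
    and nontrivial: "UNIV \<notin> null_events M R"
begin

lemma total: "f \<in> Linf M \<Longrightarrow> g \<in> Linf M \<Longrightarrow> R f g \<or> R g f"
  using pref_order unfolding pref_order_def by blast

lemma trans: "f \<in> Linf M \<Longrightarrow> g \<in> Linf M \<Longrightarrow> h \<in> Linf M \<Longrightarrow> R f g \<Longrightarrow> R g h \<Longrightarrow> R f h"
  using pref_order unfolding pref_order_def by blast

lemma UNIV_sets [simp]: "UNIV \<in> sets M"
  using sets.top[of M] space_M by simp

lemma Compl_sets [simp]: "A \<in> sets M \<Longrightarrow> - A \<in> sets M"
  using sets.compl_sets[of A M] space_M by (simp add: Compl_eq_Diff_UNIV)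

text \<open>The contrapositive of (PC): a strict preference in the opposite direction would persist
  along the tail of the sequence.\<close>

lemma pref_limit:
  assumes "\<And>n. fs n \<in> Linf M" "f \<in> Linf M" "g \<in> Linf M"
    and "\<And>n \<omega>. \<bar>fs n \<omega>\<bar> \<le> B" "\<And>\<omega>. (\<lambda>n. fs n \<omega>) \<longlonglongrightarrow> f \<omega>"
  shows "(\<And>n. R (fs n) g) \<Longrightarrow> R f g" and "(\<And>n. R g (fs n)) \<Longrightarrow> R g f"
proof -
  have *: "(strict_pref R g f \<longrightarrow> (\<exists>N. \<forall>n>N. strict_pref R g (fs n))) \<and>
      (strict_pref R f g \<longrightarrow> (\<exists>N. \<forall>n>N. strict_pref R (fs n) g))"
    using PC assms unfolding PC_def by blast
  show "R f g" if r: "\<And>n. R (fs n) g"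
  proof (rule ccontr)
    assume "\<not> R f g"
    then have "strict_pref R g f" using total assms by (auto simp: strict_pref_def)
    then obtain N where "\<forall>n>N. strict_pref R g (fs n)" using * by blast
    then show False using r[of "Suc N"] by (auto simp: strict_pref_def)
  qed
  show "R g f" if r: "\<And>n. R g (fs n)"
  proof (rule ccontr)
    assume "\<not> R g f"
    then have "strict_pref R f g" using total assms by (auto simp: strict_pref_def)
    then obtain N where "\<forall>n>N. strict_pref R (fs n) g" using * by blast
    then show False using r[of "Suc N"] by (auto simp: strict_pref_def)
  qed
qed

lemma pref_const_mono:
  assumes "A \<in> sets M" "f \<in> Linf M" "y \<le> x"
  shows "R (mix A (\<lambda>_. x) f) (mix A (\<lambda>_. y) f)"
proof (cases "A \<in> null_events M R")
  case True
  have "indiff R (mix A (\<lambda>_. x) f) f" "indiff R (mix A (\<lambda>_. y) f) f"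
    using True assms(2) unfolding null_events_def by auto
  then show ?thesis using trans[of "mix A (\<lambda>_. x) f" f "mix A (\<lambda>_. y) f"] assms by (auto simp: indiff_def)
next
  case False
  show ?thesis
  proof (cases "x = y")
    case True then show ?thesis using total[of "mix A (\<lambda>_. x) f" "mix A (\<lambda>_. x) f"] assms Linf_mix by auto
  next
    case ne: False
    then show ?thesis using SM False assms unfolding SM_def strict_pref_def by auto
  qed
qed

text \<open>(SM) concerns constants on an event only, so \<open>g\<close> is turned into
  \<open>f\<close> on one joint level set of \<open>(f, g)\<close> at a time.\<close>

lemma pref_mono_simple:
  assumes f: "f \<in> Linf M" "finite (range f)" and g: "g \<in> Linf M" "finite (range g)"
    and le: "\<And>\<omega>. g \<omega> \<le> f \<omega>"
  shows "R f g"
proof -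
  define p where "p \<omega> = (f \<omega>, g \<omega>)" for \<omega>
  have fin: "finite (range p)"
    by (rule finite_subset[of _ "range f \<times> range g"]) (auto simp: p_def f g)
  have [measurable]: "f \<in> borel_measurable M" "g \<in> borel_measurable M" using f g by (auto simp: Linf_def)
  have cell: "{\<omega>. p \<omega> = s} \<in> sets M" for s
  proof -
    have "{\<omega> \<in> space M. f \<omega> = fst s \<and> g \<omega> = snd s} \<in> sets M" by measurable
    then show ?thesis using space_M by (simp add: p_def prod_eq_iff)
  qed
  have "S \<subseteq> range p \<Longrightarrow> {\<omega>. p \<omega> \<in> S} \<in> sets M \<and> R (mix {\<omega>. p \<omega> \<in> S} f g) g" if "finite S" for S
    using that
  proof induction
    case empty
    have "mix {} f g = g" by (simp add: mix_def)
    then show ?case using total[of g g] g by simp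
  next
    case (insert s S)
    let ?h = "mix {\<omega>. p \<omega> \<in> S} f g"
    have IH: "{\<omega>. p \<omega> \<in> S} \<in> sets M" "R ?h g" using insert by auto
    have h: "?h \<in> Linf M" using Linf_mix IH f g by blast
    have un: "{\<omega>. p \<omega> \<in> insert s S} = {\<omega>. p \<omega> = s} \<union> {\<omega>. p \<omega> \<in> S}" by auto
    have sets: "{\<omega>. p \<omega> \<in> insert s S} \<in> sets M" unfolding un using cell IH by blast
    have e1: "mix {\<omega>. p \<omega> = s} (\<lambda>_. fst s) ?h = mix {\<omega>. p \<omega> \<in> insert s S} f g"
      by (auto simp: mix_def p_def fun_eq_iff)
    have e2: "mix {\<omega>. p \<omega> = s} (\<lambda>_. snd s) ?h = ?h"
      using insert.hyps by (auto simp: mix_def p_def fun_eq_iff)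
    have "snd s \<le> fst s" using insert.prems le by (auto simp: p_def)
    then have "R (mix {\<omega>. p \<omega> \<in> insert s S} f g) ?h" using pref_const_mono[OF cell h] e1 e2 by metis
    then show ?case using trans[OF Linf_mix[OF sets f(1) g(1)] h g(1)] IH sets by blast
  qed
  from this[OF fin] show ?thesis by (simp add: mix_def)
qed

lemma pref_mono:
  assumes f: "f \<in> Linf M" and g: "g \<in> Linf M" and le: "\<And>\<omega>. g \<omega> \<le> f \<omega>"
  shows "R f g"
proof -
  \<comment> \<open>\<open>f\<close> is approximated from above and \<open>g\<close> from below, so
    that every \<open>fk k\<close> dominates every \<open>gk m\<close> and the two limits can be
    taken one after the other.\<close>
  define fk where "fk k \<omega> = dyadic_floor k (f \<omega>) + 1 / 2 ^ k" for k \<omega>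
  define gk where "gk k \<omega> = dyadic_floor k (g \<omega>)" for k \<omega>
  obtain B where B: "\<And>\<omega>. \<bar>f \<omega>\<bar> \<le> B" using Linf_bound[OF f] by auto
  obtain B' where B': "\<And>\<omega>. \<bar>g \<omega>\<bar> \<le> B'" using Linf_bound[OF g] by auto
  have half: "0 \<le> 1 / (2::real) ^ k" "1 / 2 ^ k \<le> (1::real)" for k by auto
  have bf: "\<bar>fk k \<omega>\<bar> \<le> B + 2" for k \<omega>
    using dyadic_floor_abs[of k "f \<omega>"] B[of \<omega>] half[of k] unfolding fk_def by linarith
  have bg: "\<bar>gk k \<omega>\<bar> \<le> B' + 1" for k \<omega>
    using dyadic_floor_abs[of k "g \<omega>"] B'[of \<omega>] unfolding gk_def by linarith
  have fL: "fk k \<in> Linf M" for k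
    using dyadic_floor_Linf(1)[OF f, of k] bf by (intro LinfI[OF _ bf]) (auto simp: fk_def Linf_def)
  have gL: "gk k \<in> Linf M" for k
    unfolding gk_def by (rule dyadic_floor_Linf(1)[OF g])
  have ff: "finite (range (fk k))" for k
  proof -
    have "range (fk k) = (\<lambda>y. y + 1 / 2 ^ k) ` range (\<lambda>\<omega>. dyadic_floor k (f \<omega>))" by (auto simp: fk_def)
    then show ?thesis using dyadic_floor_Linf(2)[OF f] by simp
  qed
  have gf: "finite (range (gk k))" for k unfolding gk_def by (rule dyadic_floor_Linf(2)[OF g])
  have "gk m \<omega> \<le> fk k \<omega>" for k m \<omega>
    using dyadic_floor_le[of m "g \<omega>"] dyadic_floor_gt[of "f \<omega>" k] le[of \<omega>] unfolding fk_def gk_def by linarith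
  then have 1: "R (fk k) (gk m)" for k m using pref_mono_simple[OF fL ff gL gf] by blast
  have lf: "(\<lambda>k. fk k \<omega>) \<longlonglongrightarrow> f \<omega>" for \<omega>
    unfolding fk_def using tendsto_add[OF dyadic_floor_lim inverse_power2_lim] by simp
  have 2: "R f (gk m)" for m using pref_limit(1)[OF fL f gL bf lf 1] .
  have lg: "(\<lambda>k. gk k \<omega>) \<longlonglongrightarrow> g \<omega>" for \<omega> unfolding gk_def by (rule dyadic_floor_lim)
  show ?thesis using pref_limit(2)[OF gL g f bg lg 2] .
qed

lemma const_strict: "y < x \<Longrightarrow> strict_pref R (\<lambda>_. x) (\<lambda>_. y)"
proof -
  assume "y < x"
  then have "strict_pref R (mix UNIV (\<lambda>_. x) (\<lambda>_. 0)) (mix UNIV (\<lambda>_. y) (\<lambda>_. 0))"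
    using SM nontrivial unfolding SM_def by auto
  then show ?thesis by (simp add: mix_def)
qed

text \<open>The candidate is the supremum of the constants to which \<open>f\<close> is weakly
  preferred. Both halves of the indifference are limits along \<open>c - 1 / 2 ^ k\<close> and
  \<open>c + 1 / 2 ^ k\<close>, which is why the auxiliary facts carry a factor
  \<open>r\<close>.\<close>

lemma certainty_equivalent_exists:
  assumes f: "f \<in> Linf M"
  shows "\<exists>c. indiff R f (\<lambda>_. c)"
proof -
  obtain B where B: "\<And>\<omega>. \<bar>f \<omega>\<bar> \<le> B" using Linf_bound[OF f] by auto
  define S where "S = {c. R f (\<lambda>_. c)}"
  have ne: "- B \<in> S" unfolding S_def using pref_mono[OF f, of "\<lambda>_. - B"] B by (auto simp: abs_le_iff minus_le_iff)
  have ub: "c \<le> B" if "c \<in> S" for c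
  proof (rule ccontr)
    assume "\<not> c \<le> B"
    then have "strict_pref R (\<lambda>_. c) (\<lambda>_. B)" using const_strict by simp
    moreover have "R (\<lambda>_. B) f" using pref_mono[OF _ f, of "\<lambda>_. B"] B by (auto simp: abs_le_iff)
    ultimately show False using that trans[of "\<lambda>_. B" f "\<lambda>_. c"] f unfolding S_def strict_pref_def by auto
  qed
  have bdd: "bdd_above S" using ub by (rule bdd_aboveI)
  define c where "c = Sup S"
  have lim: "(\<lambda>k. c + r * (1 / 2 ^ k)) \<longlonglongrightarrow> c" for r
    using tendsto_add[OF tendsto_const tendsto_mult[OF tendsto_const inverse_power2_lim]] by fastforce
  have bnd: "\<bar>c + r * (1 / 2 ^ k)\<bar> \<le> \<bar>c\<bar> + \<bar>r\<bar>" for r k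
  proof -
    have "\<bar>r * (1 / 2 ^ k)\<bar> \<le> \<bar>r\<bar> * 1" unfolding abs_mult by (intro mult_left_mono) auto
    then show ?thesis by linarith
  qed
  have "R f (\<lambda>_. c + (- 1) * (1 / 2 ^ k))" for k
  proof -
    have "c + (- 1) * (1 / 2 ^ k) < Sup S" unfolding c_def by simp
    then obtain s where s: "s \<in> S" "c + (- 1) * (1 / 2 ^ k) < s" using less_cSup_iff[OF _ bdd] ne by blast
    then have "R (\<lambda>_. s) (\<lambda>_. c + (- 1) * (1 / 2 ^ k))" using const_strict by (auto simp: strict_pref_def)
    then show ?thesis using trans[of f "\<lambda>_. s"] s f unfolding S_def by auto
  qed
  then have 1: "R f (\<lambda>_. c)"
    using pref_limit(2)[of "\<lambda>k _. c + (- 1) * (1 / 2 ^ k)" "\<lambda>_. c" f, OF _ _ f bnd lim] by simp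
  have "R (\<lambda>_. c + 1 * (1 / 2 ^ k)) f" for k
  proof -
    have "c + 1 * (1 / 2 ^ k) \<notin> S"
    proof
      assume "c + 1 * (1 / 2 ^ k) \<in> S"
      then have "c + 1 * (1 / 2 ^ k) \<le> c" unfolding c_def using bdd by (rule cSup_upper)
      moreover have "0 < 1 * (1 / 2 ^ k :: real)" by simp
      ultimately show False by linarith
    qed
    then show ?thesis unfolding S_def using total[OF f, of "\<lambda>_. c + 1 * (1 / 2 ^ k)"] by auto
  qed
  then have 2: "R (\<lambda>_. c) f"
    using pref_limit(1)[of "\<lambda>k _. c + 1 * (1 / 2 ^ k)" "\<lambda>_. c" f, OF _ _ f bnd lim] by simp
  from 1 2 show ?thesis by (auto simp: indiff_def)
qed

definition CE :: "('a \<Rightarrow> real) \<Rightarrow> real" where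
  "CE f = (SOME c. indiff R f (\<lambda>_. c))"

lemma CE_indiff: "f \<in> Linf M \<Longrightarrow> indiff R f (\<lambda>_. CE f)"
  unfolding CE_def using certainty_equivalent_exists by (rule someI_ex)

lemma const_pref_iff: "R (\<lambda>_. x) (\<lambda>_. y) \<longleftrightarrow> y \<le> x"
  using const_strict[of y x] const_strict[of x y] total[of "\<lambda>_. x" "\<lambda>_. x"]
  by (cases x y rule: linorder_cases) (auto simp: strict_pref_def)

lemma pref_iff_CE:
  assumes "f \<in> Linf M" "g \<in> Linf M"
  shows "R f g \<longleftrightarrow> CE g \<le> CE f"
proof -
  have "R f g \<longleftrightarrow> R (\<lambda>_. CE f) (\<lambda>_. CE g)"
  proof
    assume "R f g"
    then have "R f (\<lambda>_. CE g)" using trans[of f g] CE_indiff[OF assms(2)] assms by (auto simp: indiff_def)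
    then show "R (\<lambda>_. CE f) (\<lambda>_. CE g)"
      using trans[of "\<lambda>_. CE f" f] CE_indiff[OF assms(1)] assms by (auto simp: indiff_def)
  next
    assume "R (\<lambda>_. CE f) (\<lambda>_. CE g)"
    then have "R f (\<lambda>_. CE g)" using trans[of f "\<lambda>_. CE f"] CE_indiff[OF assms(1)] assms by (auto simp: indiff_def)
    then show "R f g" using trans[of f "\<lambda>_. CE g" g] CE_indiff[OF assms(2)] assms by (auto simp: indiff_def)
  qed
  then show ?thesis by (simp add: const_pref_iff)
qed

lemma CE_const [simp]: "CE (\<lambda>_. c) = c"
  using CE_indiff[of "\<lambda>_. c"] by (simp add: indiff_def const_pref_iff)

lemma CE_mono: "f \<in> Linf M \<Longrightarrow> g \<in> Linf M \<Longrightarrow> (\<And>\<omega>. g \<omega> \<le> f \<omega>) \<Longrightarrow> CE g \<le> CE f"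
  using pref_mono pref_iff_CE by blast

lemma CE_cont:
  assumes "\<And>n. fs n \<in> Linf M" "f \<in> Linf M"
    and "\<And>n \<omega>. \<bar>fs n \<omega>\<bar> \<le> B" "\<And>\<omega>. (\<lambda>n. fs n \<omega>) \<longlonglongrightarrow> f \<omega>"
  shows "(\<lambda>n. CE (fs n)) \<longlonglongrightarrow> CE f"
proof (rule order_tendstoI)
  have *: "(strict_pref R g f \<longrightarrow> (\<exists>N. \<forall>n>N. strict_pref R g (fs n))) \<and>
      (strict_pref R f g \<longrightarrow> (\<exists>N. \<forall>n>N. strict_pref R (fs n) g))" if "g \<in> Linf M" for g
    using PC assms that unfolding PC_def by blast
  fix a assume "a < CE f"
  then have "strict_pref R f (\<lambda>_. a)" using pref_iff_CE assms(2) by (simp add: strict_pref_def)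
  then obtain N where N: "\<forall>n>N. strict_pref R (fs n) (\<lambda>_. a)" using *[of "\<lambda>_. a"] by auto
  then have "\<forall>n>N. a < CE (fs n)" using pref_iff_CE assms(1) by (auto simp: strict_pref_def)
  then show "\<forall>\<^sub>F n in sequentially. a < CE (fs n)" unfolding eventually_sequentially by (metis Suc_le_eq)
next
  have *: "(strict_pref R g f \<longrightarrow> (\<exists>N. \<forall>n>N. strict_pref R g (fs n)))" if "g \<in> Linf M" for g
    using PC assms that unfolding PC_def by blast
  fix a assume "CE f < a"
  then have "strict_pref R (\<lambda>_. a) f" using pref_iff_CE assms(2) by (simp add: strict_pref_def)
  then obtain N where N: "\<forall>n>N. strict_pref R (\<lambda>_. a) (fs n)" using *[of "\<lambda>_. a"] by auto
  then have "\<forall>n>N. CE (fs n) < a" using pref_iff_CE assms(1) by (auto simp: strict_pref_def)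
  then show "\<forall>\<^sub>F n in sequentially. CE (fs n) < a" unfolding eventually_sequentially by (metis Suc_le_eq)
qed

lemma CE_strict:
  assumes "A \<in> sets M - null_events M R" "f \<in> Linf M" "y < x"
  shows "CE (mix A (\<lambda>_. y) f) < CE (mix A (\<lambda>_. x) f)"
  using SM assms pref_iff_CE Linf_mix unfolding SM_def strict_pref_def by (metis DiffD1 Linf_const not_le)

lemma CE_sure_thing:
  assumes "A \<in> sets M" "f \<in> Linf M" "g \<in> Linf M" "h \<in> Linf M" "h' \<in> Linf M"
    and "CE (mix A f h) \<le> CE (mix A g h)"
  shows "CE (mix A f h') \<le> CE (mix A g h')"
  using ST assms pref_iff_CE Linf_mix unfolding ST_def by meson

lemma CE_sure_thing_eq:
  assumes "A \<in> sets M" "f \<in> Linf M" "g \<in> Linf M" "h \<in> Linf M" "h' \<in> Linf M"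
    and "CE (mix A f h) = CE (mix A g h)"
  shows "CE (mix A f h') = CE (mix A g h')"
  using CE_sure_thing[of A f g h h'] CE_sure_thing[of A g f h h'] assms by simp

text \<open>A certainty equivalent conditional on \<open>E\<close>. It is found with
  \<open>k\<close> itself outside \<open>E\<close>, and the sure-thing principle makes it valid for
  every other act there.\<close>

lemma event_certainty_equivalent:
  assumes E: "E \<in> sets M" and k: "k \<in> Linf M"
  shows "\<exists>e. \<forall>h\<in>Linf M. CE (mix E k h) = CE (mix E (\<lambda>_. e) h)"
proof -
  obtain B where B: "B > 0" "\<And>\<omega>. \<bar>k \<omega>\<bar> \<le> B" using Linf_bound[OF k] by auto
  have L: "mix E (\<lambda>_. x) k \<in> Linf M" for x using E k by simp
  have "continuous_on {- B..B} (\<lambda>x. CE (mix E (\<lambda>_. x) k))"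
    unfolding continuous_on_sequentially comp_def
  proof (intro allI ballI impI, elim conjE)
    fix X a assume X: "\<forall>n. X n \<in> {- B..B}" "X \<longlonglongrightarrow> a"
    show "(\<lambda>n. CE (mix E (\<lambda>_. X n) k)) \<longlonglongrightarrow> CE (mix E (\<lambda>_. a) k)"
    proof (rule CE_cont[of _ _ B])
      fix n \<omega> show "\<bar>mix E (\<lambda>_. X n) k \<omega>\<bar> \<le> B" using X(1) B(2) by (auto simp: mix_def abs_le_iff minus_le_iff)
    next
      fix \<omega> show "(\<lambda>n. mix E (\<lambda>_. X n) k \<omega>) \<longlonglongrightarrow> mix E (\<lambda>_. a) k \<omega>" using X(2) by (simp add: mix_def)
    qed (use L in auto)
  qed
  moreover have "- B \<le> k \<omega>" "k \<omega> \<le> B" for \<omega> using B(2)[of \<omega>] by auto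
  then have "CE (mix E (\<lambda>_. - B) k) \<le> CE k" "CE k \<le> CE (mix E (\<lambda>_. B) k)"
    using L k by (auto intro!: CE_mono simp: mix_def)
  ultimately obtain e where e: "CE (mix E (\<lambda>_. e) k) = CE k"
    using IVT'[of "\<lambda>x. CE (mix E (\<lambda>_. x) k)" "- B" "CE k" B] B(1) by auto
  have kk: "mix E k k = k" by (simp add: mix_def)
  have "CE (mix E k h) = CE (mix E (\<lambda>_. e) h)" if "h \<in> Linf M" for h
    by (rule CE_sure_thing_eq[OF E k _ k that]) (simp_all add: kk e)
  then show ?thesis by blast
qed

end

section \<open>Additivity over events\<close>

context preference
begin

text \<open>On such an event \<open>V\<close> is cardinal: exchanging constants there shifts
  \<open>V\<close> by an amount that ignores the rest of the act. The event can therefore be used to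
  compensate changes made elsewhere.\<close>

definition tradeoff :: "(('a \<Rightarrow> real) \<Rightarrow> real) \<Rightarrow> 'a set \<Rightarrow> (real \<Rightarrow> real) \<Rightarrow> bool" where
  "tradeoff V E v \<longleftrightarrow> E \<in> sets M \<and> continuous_on UNIV v \<and> strict_mono v \<and>
     (\<forall>k\<in>Linf M. \<forall>x y. V (mix E (\<lambda>_. y) k) - V (mix E (\<lambda>_. x) k) = v y - v x)"

lemma cells_independent3:
  assumes A: "A \<in> sets M - null_events M R" and B: "B \<in> sets M - null_events M R"
    and C: "C \<in> sets M - null_events M R"
    and disj: "A \<inter> B = {}" "A \<inter> C = {}" "B \<inter> C = {}" and cover: "A \<union> B \<union> C = UNIV"
  shows "independent3 (\<lambda>x y z. CE (mix A (\<lambda>_. x) (mix B (\<lambda>_. y) (\<lambda>_. z))))"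
proof -
  let ?c = "\<lambda>x y z. mix A (\<lambda>_. x) (mix B (\<lambda>_. y) (\<lambda>_. z))"
  have [simp]: "A \<in> sets M" "B \<in> sets M" "C \<in> sets M" using A B C by auto
  have c2: "?c x y z = mix B (\<lambda>_. y) (mix A (\<lambda>_. x) (\<lambda>_. z))" for x y z :: real
    using disj by (auto simp: mix_def fun_eq_iff)
  have c3: "?c x y z = mix C (\<lambda>_. z) (mix A (\<lambda>_. x) (\<lambda>_. y))" for x y z :: real
    using disj cover by (auto simp: mix_def fun_eq_iff)
  \<comment> \<open>Independence of a coordinate is the sure-thing principle for the complement of
    its cell, so each act is rewritten as a change on that complement.\<close>
  have i1: "?c x y z = mix (- A) (mix B (\<lambda>_. y) (\<lambda>_. z)) (\<lambda>_. x)" for x y z :: real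
    by (auto simp: mix_def fun_eq_iff)
  have i2: "?c x y z = mix (- B) (mix A (\<lambda>_. x) (\<lambda>_. z)) (\<lambda>_. y)" for x y z :: real
    using disj by (auto simp: mix_def fun_eq_iff)
  have i3: "?c x y z = mix (- C) (mix A (\<lambda>_. x) (\<lambda>_. y)) (\<lambda>_. z)" for x y z :: real
    using disj cover by (auto simp: mix_def fun_eq_iff)
  show ?thesis
  proof
    show "CE (?c x y z) < CE (?c x' y z)" if "x < x'" for x x' y z
      using CE_strict[OF A _ that] by simp
    show "CE (?c x y z) < CE (?c x y' z)" if "y < y'" for x y y' z
      unfolding c2 using CE_strict[OF B _ that] by simp
    show "CE (?c x y z) < CE (?c x y z')" if "z < z'" for x y z z'
      unfolding c3 using CE_strict[OF C _ that] by simp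
    show "CE (?c t y z) \<le> CE (?c t y' z')" if "CE (?c x y z) \<le> CE (?c x y' z')" for x t y z y' z'
      using that unfolding i1 by (rule CE_sure_thing[of "- A" _ _ "\<lambda>_. x", rotated 5]) auto
    show "CE (?c x t z) \<le> CE (?c x' t z')" if "CE (?c x y z) \<le> CE (?c x' y z')" for y t x z x' z'
      using that unfolding i2 by (rule CE_sure_thing[of "- B" _ _ "\<lambda>_. y", rotated 5]) auto
    show "CE (?c x y t) \<le> CE (?c x' y' t)" if "CE (?c x y z) \<le> CE (?c x' y' z)" for z t x y x' y'
      using that unfolding i3 by (rule CE_sure_thing[of "- C" _ _ "\<lambda>_. z", rotated 5]) auto
    show "(\<lambda>n. CE (?c (X n) (Y n) (Z n))) \<longlonglongrightarrow> CE (?c x y z)"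
      if lim: "X \<longlonglongrightarrow> x" "Y \<longlonglongrightarrow> y" "Z \<longlonglongrightarrow> z" for X Y Z x y z
    proof -
      have bdd: "\<exists>b. \<forall>n. \<bar>S n\<bar> \<le> b" if "S \<longlonglongrightarrow> s" for S and s :: real
        using that[THEN convergentI, THEN convergent_imp_Bseq] unfolding Bseq_def by auto
      obtain a where a: "\<And>n. \<bar>X n\<bar> \<le> a" using bdd[OF lim(1)] by blast
      obtain b where b: "\<And>n. \<bar>Y n\<bar> \<le> b" using bdd[OF lim(2)] by blast
      obtain c where c: "\<And>n. \<bar>Z n\<bar> \<le> c" using bdd[OF lim(3)] by blast
      have "\<bar>?c (X n) (Y n) (Z n) \<omega>\<bar> \<le> max a (max b c)" for n \<omega>
        using a[of n] b[of n] c[of n] by (auto simp: mix_def)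
      moreover have "(\<lambda>n. ?c (X n) (Y n) (Z n) \<omega>) \<longlonglongrightarrow> ?c x y z \<omega>" for \<omega>
        using lim by (simp add: mix_def)
      ultimately show ?thesis by (intro CE_cont) auto
    qed
  qed
qed

lemma tradeoff_rep_exists:
  assumes A: "A \<in> sets M - null_events M R" and B: "B \<in> sets M - null_events M R"
    and C: "C \<in> sets M - null_events M R"
    and disj: "A \<inter> B = {}" "A \<inter> C = {}" "B \<inter> C = {}" and cover: "A \<union> B \<union> C = UNIV"
  shows "\<exists>\<phi> u v. strict_mono \<phi> \<and> continuous_on UNIV \<phi> \<and> \<phi> 0 = 0 \<and>
    tradeoff (\<lambda>f. \<phi> (CE f)) A u \<and> tradeoff (\<lambda>f. \<phi> (CE f)) B v"
proof -
  let ?c = "\<lambda>x y z. mix A (\<lambda>_. x) (mix B (\<lambda>_. y) (\<lambda>_. z))"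
  let ?W = "\<lambda>x y z. CE (?c x y z)"
  have [simp]: "A \<in> sets M" "B \<in> sets M" "C \<in> sets M" using A B C by auto
  interpret W: independent3 ?W using cells_independent3[OF assms] .
  obtain u v w where uvw: "additive_rep ?W u v w" using W.additive_rep_exists by blast
  then have cont: "continuous_on UNIV u" "continuous_on UNIV v" "continuous_on UNIV w"
    and rep: "\<And>x y z x' y' z'. ?W x y z \<le> ?W x' y' z' \<longleftrightarrow> u x + v y + w z \<le> u x' + v y' + w z'"
    unfolding additive_rep_def by blast+
  have mono: "strict_mono u" "strict_mono v" "strict_mono w"
  proof -
    show "strict_mono u" using rep[of _ 0 0 _ 0 0] W.mono1[of _ _ 0 0] by (intro strict_monoI) (smt (verit))
    show "strict_mono v" using rep[of 0 _ 0 0 _ 0] W.mono2[of _ _ 0 0] by (intro strict_monoI) (smt (verit))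
    show "strict_mono w" using rep[of 0 0 _ 0 0 _] W.mono3[of _ _ 0 0] by (intro strict_monoI) (smt (verit))
  qed
  \<comment> \<open>The utility of the triple \<open>(t, t, t)\<close>, that is, of the constant act
    \<open>t\<close>, shifted to vanish at \<open>0\<close>.\<close>
  define \<phi> where "\<phi> t = u t + v t + w t - (u 0 + v 0 + w 0)" for t
  have \<phi>: "strict_mono \<phi>" "continuous_on UNIV \<phi>" "\<phi> 0 = 0"
    using mono unfolding \<phi>_def by (auto simp: strict_mono_def intro!: add_strict_mono continuous_intros cont)
  have const: "?c t t t = (\<lambda>_. t)" for t :: real by (auto simp: mix_def)
  have V: "\<phi> (?W x y z) = u x + v y + w z - (u 0 + v 0 + w 0)" for x y z
  proof -
    define t where "t = ?W x y z"
    have "?W t t t = ?W x y z" unfolding const t_def by simp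
    then have "u t + v t + w t = u x + v y + w z" using rep[of t t t x y z] rep[of x y z t t t] by linarith
    then show ?thesis unfolding \<phi>_def t_def by simp
  qed
  \<comment> \<open>An arbitrary act is made constant on each remaining cell by conditional
    certainty equivalents, which reduces it to a triple. The constants do not depend on the value
    placed on the changed cell.\<close>
  have equiv: "\<exists>a b c. (\<forall>x. CE (mix A (\<lambda>_. x) k) = ?W x b c) \<and> (\<forall>y. CE (mix B (\<lambda>_. y) k) = ?W a y c)"
    if k: "k \<in> Linf M" for k
  proof -
    obtain a where a: "\<And>h. h \<in> Linf M \<Longrightarrow> CE (mix A k h) = CE (mix A (\<lambda>_. a) h)"
      using event_certainty_equivalent[of A k] k by auto
    obtain b where b: "\<And>h. h \<in> Linf M \<Longrightarrow> CE (mix B k h) = CE (mix B (\<lambda>_. b) h)"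
      using event_certainty_equivalent[of B k] k by auto
    obtain c where c: "\<And>h. h \<in> Linf M \<Longrightarrow> CE (mix C k h) = CE (mix C (\<lambda>_. c) h)"
      using event_certainty_equivalent[of C k] k by auto
    have "CE (mix A (\<lambda>_. x) k) = ?W x b c" for x
    proof -
      have "mix A (\<lambda>_. x) k = mix B k (mix A (\<lambda>_. x) k)" using disj by (auto simp: mix_def fun_eq_iff)
      then have "CE (mix A (\<lambda>_. x) k) = CE (mix B (\<lambda>_. b) (mix A (\<lambda>_. x) k))" using b[of "mix A (\<lambda>_. x) k"] k by simp
      also have "mix B (\<lambda>_. b) (mix A (\<lambda>_. x) k) = mix C k (mix B (\<lambda>_. b) (mix A (\<lambda>_. x) k))"
        using disj by (auto simp: mix_def fun_eq_iff)
      also have "CE \<dots> = CE (mix C (\<lambda>_. c) (mix B (\<lambda>_. b) (mix A (\<lambda>_. x) k)))" using c k by simp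
      also have "mix C (\<lambda>_. c) (mix B (\<lambda>_. b) (mix A (\<lambda>_. x) k)) = ?c x b c"
        using disj cover by (auto simp: mix_def fun_eq_iff)
      finally show ?thesis .
    qed
    moreover have "CE (mix B (\<lambda>_. y) k) = ?W a y c" for y
    proof -
      have "mix B (\<lambda>_. y) k = mix A k (mix B (\<lambda>_. y) k)" using disj by (auto simp: mix_def fun_eq_iff)
      then have "CE (mix B (\<lambda>_. y) k) = CE (mix A (\<lambda>_. a) (mix B (\<lambda>_. y) k))" using a[of "mix B (\<lambda>_. y) k"] k by simp
      also have "mix A (\<lambda>_. a) (mix B (\<lambda>_. y) k) = mix C k (mix A (\<lambda>_. a) (mix B (\<lambda>_. y) k))"
        using disj by (auto simp: mix_def fun_eq_iff)
      also have "CE \<dots> = CE (mix C (\<lambda>_. c) (mix A (\<lambda>_. a) (mix B (\<lambda>_. y) k)))" using c k by simp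
      also have "mix C (\<lambda>_. c) (mix A (\<lambda>_. a) (mix B (\<lambda>_. y) k)) = ?c a y c"
        using disj cover by (auto simp: mix_def fun_eq_iff)
      finally show ?thesis .
    qed
    ultimately show ?thesis by blast
  qed
  have "\<phi> (CE (mix A (\<lambda>_. y) k)) - \<phi> (CE (mix A (\<lambda>_. x) k)) = u y - u x"
    "\<phi> (CE (mix B (\<lambda>_. y) k)) - \<phi> (CE (mix B (\<lambda>_. x) k)) = v y - v x" if k: "k \<in> Linf M" for k x y
  proof -
    obtain a b c where "\<And>x. CE (mix A (\<lambda>_. x) k) = ?W x b c" "\<And>y. CE (mix B (\<lambda>_. y) k) = ?W a y c"
      using equiv[OF k] by blast
    then show "\<phi> (CE (mix A (\<lambda>_. y) k)) - \<phi> (CE (mix A (\<lambda>_. x) k)) = u y - u x"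
      "\<phi> (CE (mix B (\<lambda>_. y) k)) - \<phi> (CE (mix B (\<lambda>_. x) k)) = v y - v x" by (simp_all add: V)
  qed
  then have "tradeoff (\<lambda>f. \<phi> (CE f)) A u" "tradeoff (\<lambda>f. \<phi> (CE f)) B v"
    unfolding tradeoff_def using cont mono by simp_all
  with \<phi> show ?thesis by blast
qed

end

section \<open>Increments on an event do not depend on the act elsewhere\<close>

locale tradeoff_rep = preference +
  fixes V :: "('a \<Rightarrow> real) \<Rightarrow> real"
  assumes V_rep: "\<And>f g. f \<in> Linf M \<Longrightarrow> g \<in> Linf M \<Longrightarrow> R f g \<longleftrightarrow> V g \<le> V f"
    and V_cont: "\<And>fs f B. (\<And>n. fs n \<in> Linf M) \<Longrightarrow> f \<in> Linf M \<Longrightarrow> (\<And>n \<omega>. \<bar>fs n \<omega>\<bar> \<le> B) \<Longrightarrow>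
      (\<And>\<omega>. (\<lambda>n. fs n \<omega>) \<longlonglongrightarrow> f \<omega>) \<Longrightarrow> (\<lambda>n. V (fs n)) \<longlonglongrightarrow> V f"
begin

lemma V_sure_thing_eq:
  assumes "A \<in> sets M" "f \<in> Linf M" "g \<in> Linf M" "h \<in> Linf M" "h' \<in> Linf M"
    and "V (mix A f h) = V (mix A g h)"
  shows "V (mix A f h') = V (mix A g h')"
proof -
  have "R (mix A f h) (mix A g h)" "R (mix A g h) (mix A f h)" using V_rep assms by auto
  then have "R (mix A f h') (mix A g h')" "R (mix A g h') (mix A f h')"
    using ST assms(1-5) unfolding ST_def by blast+
  then show ?thesis using V_rep assms by auto
qed

lemma event_equivalent:
  assumes "E \<in> sets M" "k \<in> Linf M"
  shows "\<exists>e. \<forall>h\<in>Linf M. V (mix E k h) = V (mix E (\<lambda>_. e) h)"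
proof -
  obtain e where e: "\<And>h. h \<in> Linf M \<Longrightarrow> CE (mix E k h) = CE (mix E (\<lambda>_. e) h)"
    using event_certainty_equivalent[OF assms] by blast
  have "V (mix E k h) = V (mix E (\<lambda>_. e) h)" if h: "h \<in> Linf M" for h
  proof -
    have L: "mix E k h \<in> Linf M" "mix E (\<lambda>_. e) h \<in> Linf M" using assms h by auto
    show ?thesis
      using V_rep[OF L] V_rep[OF L(2,1)] pref_iff_CE[OF L] pref_iff_CE[OF L(2,1)] e[OF h] by linarith
  qed
  then show ?thesis by blast
qed

lemma increment_indep_small:
  assumes E: "tradeoff V E v" and D: "D \<in> sets M" "D \<inter> E = {}"
    and L: "f \<in> Linf M" "g \<in> Linf M" "h \<in> Linf M" "h' \<in> Linf M"
    and y: "V (mix D f h) - V (mix D g h) = v y - v 0"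
  shows "V (mix D f h') - V (mix D g h') = V (mix D f h) - V (mix D g h)"
proof -
  have Es [simp]: "E \<in> sets M"
    and tr: "\<And>k x y. k \<in> Linf M \<Longrightarrow> V (mix E (\<lambda>_. y) k) - V (mix E (\<lambda>_. x) k) = v y - v x"
    using E unfolding tradeoff_def by blast+
  note [simp] = D(1) L
  have comm: "mix E (\<lambda>_. x) (mix D p k) = mix D p (mix E (\<lambda>_. x) k)" for x :: real and p k
    using D(2) by (auto simp: mix_def fun_eq_iff)
  \<comment> \<open>On \<open>E\<close> the act \<open>k\<close> may be replaced by an equivalent
    constant, and the tradeoff property shifts both terms equally when that constant is changed to
    \<open>x\<close>.\<close>
  have norm: "V (mix D f k) - V (mix D g k) = V (mix D f (mix E (\<lambda>_. x) k)) - V (mix D g (mix E (\<lambda>_. x) k))"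
    if k [simp]: "k \<in> Linf M" for k x
  proof -
    obtain e where e: "\<And>h. h \<in> Linf M \<Longrightarrow> V (mix E k h) = V (mix E (\<lambda>_. e) h)"
      using event_equivalent[OF Es k] by blast
    have "V (mix D p k) = V (mix E (\<lambda>_. e) (mix D p k))" if "p \<in> Linf M" for p
    proof -
      have "mix D p k = mix E k (mix D p k)" using D(2) by (auto simp: mix_def fun_eq_iff)
      then show ?thesis using e[of "mix D p k"] that by simp
    qed
    then show ?thesis using tr[of "mix D f k" e x] tr[of "mix D g k" e x] by (simp add: comm)
  qed
  let ?k = "\<lambda>h. mix E (\<lambda>_. 0) h"
  have un: "mix D p (mix E (\<lambda>_. x) k) = mix (D \<union> E) (mix D p (\<lambda>_. x)) k" for p k and x :: real
    by (auto simp: mix_def fun_eq_iff)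
  have g_y: "V (mix D g (mix E (\<lambda>_. y) k)) - V (mix D g (mix E (\<lambda>_. 0) k)) = v y - v 0" if "k \<in> Linf M" for k
    using tr[of "mix D g k" 0 y] that by (simp add: comm)
  \<comment> \<open>The advantage of \<open>f\<close> over \<open>g\<close> on \<open>D\<close> is
    offset by \<open>y\<close> instead of \<open>0\<close> on \<open>E\<close>. The resulting
    indifference concerns an act on \<open>D \<union> E\<close> only, so the sure-thing principle
    carries it from \<open>h\<close> to \<open>h'\<close>.\<close>
  have "V (mix D f (?k h)) = V (mix D g (mix E (\<lambda>_. y) h))"
    using norm[of h 0] y g_y[of h] by simp
  then have "V (mix D f (?k h')) = V (mix D g (mix E (\<lambda>_. y) h'))"
    unfolding un by (rule V_sure_thing_eq[rotated 5]) (auto simp: D L)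
  then show ?thesis using norm[of h' 0] g_y[of h'] y by simp
qed

lemma increment_indep_disjoint:
  assumes E: "tradeoff V E v" and D: "D \<in> sets M" "D \<inter> E = {}"
    and L: "f \<in> Linf M" "g \<in> Linf M" "h \<in> Linf M" "h' \<in> Linf M"
  shows "V (mix D f h) - V (mix D g h) = V (mix D f h') - V (mix D g h')"
proof -
  have cv: "continuous_on UNIV v" and mv: "strict_mono v" using E unfolding tradeoff_def by auto
  \<comment> \<open>Every amount below \<open>d\<close> in absolute value is
    \<open>v y - v 0\<close> for some \<open>y\<close> between \<open>- 1\<close> and
    \<open>1\<close>, hence can be compensated on \<open>E\<close>.\<close>
  define d where "d = min (v 1 - v 0) (v 0 - v (- 1))"
  have d: "d > 0" using strict_monoD[OF mv, of 0 1] strict_monoD[OF mv, of "- 1" 0] by (simp add: d_def)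
  have solve: "\<exists>y. r = v y - v 0" if "\<bar>r\<bar> < d" for r
  proof -
    have "v (- 1) \<le> v 0 + r" "v 0 + r \<le> v 1" using that unfolding d_def by auto
    then obtain y where "v y = v 0 + r" using IVT'[of v "- 1" "v 0 + r" 1] continuous_on_subset[OF cv] by auto
    then show ?thesis by (intro exI[of _ y]) simp
  qed
  \<comment> \<open>The utility on \<open>E\<close> may have a small range, so the change from \<open>g\<close> to \<open>f\<close> is cut into pieces
    that can be compensated on \<open>E\<close>.\<close>
  define p where "p t \<omega> = g \<omega> + t * (f \<omega> - g \<omega>)" for t :: real and \<omega>
  obtain Bf Bg where B: "\<And>\<omega>. \<bar>f \<omega>\<bar> \<le> Bf" "\<And>\<omega>. \<bar>g \<omega>\<bar> \<le> Bg" "Bf > 0" "Bg > 0" 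
    using Linf_bound[OF L(1)] Linf_bound[OF L(2)] by auto
  have pb: "\<bar>p t \<omega>\<bar> \<le> Bg + (Bf + Bg)" if "0 \<le> t" "t \<le> 1" for t \<omega>
  proof -
    have "\<bar>t * (f \<omega> - g \<omega>)\<bar> \<le> 1 * (Bf + Bg)"
      unfolding abs_mult using that B(1)[of \<omega>] B(2)[of \<omega>] by (intro mult_mono) auto
    then have "\<bar>g \<omega>\<bar> + \<bar>t * (f \<omega> - g \<omega>)\<bar> \<le> Bg + (Bf + Bg)" 
      using add_mono[OF B(2)[of \<omega>], of "\<bar>t * (f \<omega> - g \<omega>)\<bar>" "Bf + Bg"] unfolding mult_1 by blast
    then show ?thesis unfolding p_def by (rule order_trans[OF abs_triangle_ineq])
  qed
  have pL: "p t \<in> Linf M" if "0 \<le> t" "t \<le> 1" for t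
  proof -
    have [measurable]: "f \<in> borel_measurable M" "g \<in> borel_measurable M" using L by (auto simp: Linf_def)
    have "p t \<in> borel_measurable M" unfolding p_def by measurable
    then show ?thesis using pb[OF that] by (rule LinfI)
  qed
  have "continuous_on {0..1} (\<lambda>t. V (mix D (p t) h))"
    unfolding continuous_on_sequentially comp_def
  proof (intro allI ballI impI, elim conjE)
    fix X a assume X: "\<forall>n. X n \<in> {0..1}" "X \<longlonglongrightarrow> a" "a \<in> {0..(1::real)}"
    obtain Bh where Bh: "\<And>\<omega>. \<bar>h \<omega>\<bar> \<le> Bh" using Linf_bound[OF L(3)] by auto
    show "(\<lambda>n. V (mix D (p (X n)) h)) \<longlonglongrightarrow> V (mix D (p a) h)"
    proof (rule V_cont)
      fix n \<omega> show "\<bar>mix D (p (X n)) h \<omega>\<bar> \<le> max (Bg + (Bf + Bg)) Bh"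
      proof -
        have "\<bar>p (X n) \<omega>\<bar> \<le> Bg + (Bf + Bg)" using X(1) by (intro pb) auto
        then show ?thesis using Bh[of \<omega>] unfolding mix_def by (cases "\<omega> \<in> D") (simp_all add: le_max_iff_disj)
      qed
    next
      fix \<omega> show "(\<lambda>n. mix D (p (X n)) h \<omega>) \<longlonglongrightarrow> mix D (p a) h \<omega>"
        unfolding mix_def p_def by (cases "\<omega> \<in> D") (auto intro!: tendsto_intros X(2))
    qed (use X L pL D in auto)
  qed
  then have "uniformly_continuous_on {0..1} (\<lambda>t. V (mix D (p t) h))"
    by (intro compact_uniformly_continuous) auto
  then obtain e where e: "e > 0" "\<And>s t. s \<in> {0..1} \<Longrightarrow> t \<in> {0..1} \<Longrightarrow> dist t s < e \<Longrightarrow>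
      dist (V (mix D (p t) h)) (V (mix D (p s) h)) < d"
    unfolding uniformly_continuous_on_def using d by metis
  obtain n :: nat where n: "1 / e < n" "n > 0" using reals_Archimedean2[of "max (1 / e) 0"] by auto
  have ne: "1 / n < e" using n e by (simp add: field_simps)
  define F where "F k i = V (mix D (p (real i / n)) k)" for k i
  \<comment> \<open>Smallness of the pieces is known for the outside act \<open>h\<close> only. This
    suffices, since \<open>increment_indep_small\<close> asks for compensation at \<open>h\<close>
    and concludes the equality at \<open>h'\<close>.\<close>
  have step: "F h' (Suc i) - F h' i = F h (Suc i) - F h i" if "i < n" for i
  proof -
    have t: "real i / n \<in> {0..1}" "real (Suc i) / n \<in> {0..1}" using that by auto
    have "dist (real (Suc i) / n) (real i / n) = 1 / n" by (simp add: dist_real_def add_divide_distrib)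
    then have "\<bar>F h (Suc i) - F h i\<bar> < d" using e(2)[OF t] ne unfolding F_def dist_real_def by simp
    then obtain y where "F h (Suc i) - F h i = v y - v 0" using solve by blast
    then show ?thesis
      using increment_indep_small[OF E D _ _ L(3,4), of "p (real (Suc i) / n)" "p (real i / n)" y] t pL
      unfolding F_def by simp
  qed
  have "F k n - F k 0 = (\<Sum>i<n. F k (Suc i) - F k i)" for k by (simp add: sum_lessThan_telescope)
  then have "F h' n - F h' 0 = F h n - F h 0" using step by simp
  moreover have "F k n = V (mix D f k)" "F k 0 = V (mix D g k)" for k
    using n unfolding F_def p_def by simp_all
  ultimately show ?thesis by simp
qed

text \<open>\<open>D\<close> may meet both tradeoff events. Its part inside \<open>A\<close> is
  disjoint from \<open>B\<close> and is compensated there, the rest is disjoint from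
  \<open>A\<close> and is compensated on \<open>A\<close>.\<close>

lemma increment_indep:
  assumes E: "tradeoff V A u" "tradeoff V B v" "A \<inter> B = {}" and D: "D \<in> sets M"
    and L: "f \<in> Linf M" "g \<in> Linf M" "h \<in> Linf M" "h' \<in> Linf M"
  shows "V (mix D f h) - V (mix D g h) = V (mix D f h') - V (mix D g h')"
proof -
  have A: "A \<in> sets M" using E unfolding tradeoff_def by blast
  have s: "D \<inter> A \<in> sets M" "D - A \<in> sets M" using A D by auto
  have split: "V (mix D f k) - V (mix D g k) =
      (V (mix (D \<inter> A) f (mix (D - A) f k)) - V (mix (D \<inter> A) g (mix (D - A) f k))) +
      (V (mix (D - A) f (mix (D \<inter> A) g k)) - V (mix (D - A) g (mix (D \<inter> A) g k)))" for k
  proof -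
    have "mix D f k = mix (D \<inter> A) f (mix (D - A) f k)" "mix D g k = mix (D - A) g (mix (D \<inter> A) g k)"
      "mix (D \<inter> A) g (mix (D - A) f k) = mix (D - A) f (mix (D \<inter> A) g k)"
      by (auto simp: mix_def fun_eq_iff)
    then show ?thesis by simp
  qed
  have "V (mix (D \<inter> A) f (mix (D - A) f h)) - V (mix (D \<inter> A) g (mix (D - A) f h)) =
      V (mix (D \<inter> A) f (mix (D - A) f h')) - V (mix (D \<inter> A) g (mix (D - A) f h'))"
    using E(3) s L by (intro increment_indep_disjoint[OF E(2)]) auto
  moreover have "V (mix (D - A) f (mix (D \<inter> A) g h)) - V (mix (D - A) g (mix (D \<inter> A) g h)) =
      V (mix (D - A) f (mix (D \<inter> A) g h')) - V (mix (D - A) g (mix (D \<inter> A) g h'))"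
    using s L by (intro increment_indep_disjoint[OF E(1)]) auto
  ultimately show ?thesis unfolding split by simp
qed

end

section \<open>Extending functions from the dyadic rationals\<close>

definition dyadic_mono :: "(real \<Rightarrow> real) \<Rightarrow> bool" where
  "dyadic_mono g \<longleftrightarrow> (\<forall>(k::nat) (i::int) (j::int). i < j \<longrightarrow> g (real_of_int i / 2 ^ k) < g (real_of_int j / 2 ^ k))"

text \<open>The grid of level \<open>k\<close> on \<open>[- n, n]\<close>, with indices shifted to
  natural numbers so that a leftmost offending interval exists. Tolerances of the form
  \<open>1 / (real m + 1)\<close> keep the family of conditions countable.\<close>

definition small_increments :: "(real \<Rightarrow> real) \<Rightarrow> nat \<Rightarrow> nat \<Rightarrow> nat \<Rightarrow> bool" where
  "small_increments g n m k \<longleftrightarrow>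
     (\<forall>i<2 * n * 2 ^ k. g (real (Suc i) / 2 ^ k - n) - g (real i / 2 ^ k - n) < 1 / (real m + 1))"

definition dyadic_limit :: "(real \<Rightarrow> real) \<Rightarrow> real \<Rightarrow> real" where
  "dyadic_limit g x = lim (\<lambda>k. g (dyadic_floor k x))"

lemma dyadic_mono_less:
  assumes "dyadic_mono g" and lt: "real_of_int i / 2 ^ k < real_of_int j / 2 ^ l"
  shows "g (real_of_int i / 2 ^ k) < g (real_of_int j / 2 ^ l)"
proof -
  have e: "real_of_int i / 2 ^ k = real_of_int (i * 2 ^ l) / 2 ^ (k + l)"
    "real_of_int j / 2 ^ l = real_of_int (j * 2 ^ k) / 2 ^ (k + l)" by (auto simp: power_add)
  have "real_of_int (i * 2 ^ l) < real_of_int (j * 2 ^ k)"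
    using lt unfolding e by (simp add: divide_less_cancel)
  then have "i * 2 ^ l < j * 2 ^ k" by linarith
  then show ?thesis using assms(1) unfolding e dyadic_mono_def by blast
qed

lemma dyadic_mono_le:
  assumes "dyadic_mono g" and "real_of_int i / 2 ^ k \<le> real_of_int j / 2 ^ l"
  shows "g (real_of_int i / 2 ^ k) \<le> g (real_of_int j / 2 ^ l)"
proof (cases "real_of_int i / 2 ^ k = real_of_int j / 2 ^ l")
  case False
  then have "real_of_int i / 2 ^ k < real_of_int j / 2 ^ l" using assms(2) by linarith
  then show ?thesis using dyadic_mono_less[OF assms(1)] less_imp_le by blast
qed simp

lemma dyadic_floor_greatest:
  assumes "real_of_int i / 2 ^ k \<le> x"
  shows "real_of_int i / 2 ^ k \<le> dyadic_floor k x"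
proof -
  have "real_of_int i \<le> x * 2 ^ k" using assms by (simp add: divide_le_eq)
  then have "i \<le> \<lfloor>x * 2 ^ k\<rfloor>" by (simp add: le_floor_iff)
  then show ?thesis unfolding dyadic_floor_def by (simp add: divide_right_mono)
qed

lemma dyadic_floor_Suc: "dyadic_floor k x \<le> dyadic_floor (Suc k) x"
proof -
  have e: "dyadic_floor k x = real_of_int (\<lfloor>x * 2 ^ k\<rfloor> * 2) / 2 ^ Suc k" unfolding dyadic_floor_def by simp
  show ?thesis unfolding e by (rule dyadic_floor_greatest) (use dyadic_floor_le[of k x] e in simp)
qed

lemma dyadic_limit_tendsto:
  assumes g: "dyadic_mono g"
  shows "(\<lambda>k. g (dyadic_floor k x)) \<longlonglongrightarrow> dyadic_limit g x"
    and "g (dyadic_floor k x) \<le> dyadic_limit g x"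
    and "x \<le> real_of_int j / 2 ^ l \<Longrightarrow> dyadic_limit g x \<le> g (real_of_int j / 2 ^ l)"
proof -
  have inc: "incseq (\<lambda>k. g (dyadic_floor k x))"
  proof (rule incseq_SucI)
    fix k show "g (dyadic_floor k x) \<le> g (dyadic_floor (Suc k) x)"
      using dyadic_floor_Suc[of k x] unfolding dyadic_floor_def by (rule dyadic_mono_le[OF g])
  qed
  have ub: "g (dyadic_floor k x) \<le> g (real_of_int j / 2 ^ l)" if "x \<le> real_of_int j / 2 ^ l" for k j l
    using order_trans[OF dyadic_floor_le that] unfolding dyadic_floor_def by (rule dyadic_mono_le[OF g])
  have "x \<le> real_of_int \<lceil>x\<rceil> / 2 ^ 0" by simp
  then obtain L where L: "(\<lambda>k. g (dyadic_floor k x)) \<longlonglongrightarrow> L"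
    using incseq_convergent[OF inc, of "g (real_of_int \<lceil>x\<rceil> / 2 ^ 0)"] ub[of "\<lceil>x\<rceil>" 0] by metis
  then have eq: "dyadic_limit g x = L" unfolding dyadic_limit_def by (rule limI)
  show "(\<lambda>k. g (dyadic_floor k x)) \<longlonglongrightarrow> dyadic_limit g x" using L unfolding eq .
  show "g (dyadic_floor k x) \<le> dyadic_limit g x" unfolding eq by (rule incseq_le[OF inc L])
  show "dyadic_limit g x \<le> g (real_of_int j / 2 ^ l)" if "x \<le> real_of_int j / 2 ^ l"
    unfolding eq by (rule LIMSEQ_le_const2[OF L]) (use ub[OF that] in blast)
qed

lemma dyadic_limit_ge:
  assumes g: "dyadic_mono g" and "real_of_int j / 2 ^ l \<le> x"
  shows "g (real_of_int j / 2 ^ l) \<le> dyadic_limit g x"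
proof -
  have "g (real_of_int j / 2 ^ l) \<le> g (dyadic_floor l x)"
    using dyadic_floor_greatest[OF assms(2)] unfolding dyadic_floor_def by (rule dyadic_mono_le[OF g])
  then show ?thesis using dyadic_limit_tendsto(2)[OF g] order_trans by blast
qed

lemma dyadic_limit_dyadic:
  assumes "dyadic_mono g"
  shows "dyadic_limit g (real_of_int j / 2 ^ l) = g (real_of_int j / 2 ^ l)"
  by (rule order.antisym[OF dyadic_limit_tendsto(3)[OF assms order_refl] dyadic_limit_ge[OF assms order_refl]])

lemma dyadic_limit_strict_mono:
  assumes g: "dyadic_mono g"
  shows "strict_mono (dyadic_limit g)"
proof (rule strict_monoI)
  fix x y :: real assume "x < y"
  \<comment> \<open>Half of the distance is taken so that a complete grid interval fits between
    \<open>x\<close> and \<open>y\<close>; its increment is strictly positive.\<close>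
  then have "0 < (y - x) / 2" by simp
  then have "\<forall>\<^sub>F k in sequentially. 1 / 2 ^ k < (y - x) / 2" by (rule order_tendstoD(2)[OF inverse_power2_lim])
  then obtain k where k: "1 / 2 ^ k < (y - x) / 2" by (meson eventually_sequentially le_refl)
  define j where "j = \<lfloor>x * 2 ^ k\<rfloor>"
  have j: "dyadic_floor k x = real_of_int j / 2 ^ k" by (simp add: dyadic_floor_def j_def)
  have s: "real_of_int (j + 1) / 2 ^ k = real_of_int j / 2 ^ k + 1 / 2 ^ k"
    "real_of_int (j + 2) / 2 ^ k = real_of_int j / 2 ^ k + 2 * (1 / 2 ^ k)" by (simp_all add: add_divide_distrib)
  have 1: "x \<le> real_of_int (j + 1) / 2 ^ k" using dyadic_floor_gt[of x k] unfolding s j by (rule less_imp_le)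
  have "2 * (1 / 2 ^ k) \<le> y - x" using mult_strict_left_mono[OF k, of 2] by simp
  then have 2: "real_of_int (j + 2) / 2 ^ k \<le> y"
    using add_mono[OF dyadic_floor_le[of k x]] unfolding s(2) j by fastforce
  have "dyadic_limit g x \<le> g (real_of_int (j + 1) / 2 ^ k)" by (rule dyadic_limit_tendsto(3)[OF g 1])
  also have "\<dots> < g (real_of_int (j + 2) / 2 ^ k)" by (rule g[unfolded dyadic_mono_def, rule_format]) simp
  also have "\<dots> \<le> dyadic_limit g y" by (rule dyadic_limit_ge[OF g 2])
  finally show "dyadic_limit g x < dyadic_limit g y" .
qed

lemma dyadic_limit_continuous:
  assumes g: "dyadic_mono g" and c: "\<And>n m. \<exists>k. small_increments g n m k"
  shows "continuous_on UNIV (dyadic_limit g)"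
  unfolding continuous_on_eq_continuous_at[OF open_UNIV] continuous_at_eps_delta
proof (intro ballI allI impI)
  fix x e :: real assume e: "0 < e"
  \<comment> \<open>The margin \<open>2\<close> keeps the grid interval containing \<open>x\<close>
    and its two neighbours inside \<open>[- n, n]\<close>. A point within \<open>1 / 2 ^ k\<close>
    of \<open>x\<close> lies in these three intervals, and two increments bound the difference,
    hence the factor \<open>2\<close> below.\<close>
  obtain n :: nat where n: "\<bar>x\<bar> + 2 < n" using reals_Archimedean2 by blast
  obtain m :: nat where m: "2 / e < m" using reals_Archimedean2 by blast
  have em: "2 * (1 / (real m + 1)) < e" using m e by (simp add: field_simps)
  obtain k where k: "small_increments g n m k" using c by blast
  have inc: "g (real_of_int (j + 1) / 2 ^ k) - g (real_of_int j / 2 ^ k) < 1 / (real m + 1)"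
    if "- int n * 2 ^ k \<le> j" "j < int n * 2 ^ k" for j
  proof -
    define i where "i = nat (j + int n * 2 ^ k)"
    have ji: "int i = j + int n * 2 ^ k" using that by (simp add: i_def)
    then have "int i < int (2 * n * 2 ^ k)" using that by simp
    then have "i < 2 * n * 2 ^ k" by linarith
    moreover have "real i = real_of_int j + real n * 2 ^ k" using ji by (metis of_int_add of_int_mult of_int_of_nat_eq of_int_power of_int_numeral)
    then have "real (Suc i) / 2 ^ k - n = real_of_int (j + 1) / 2 ^ k" "real i / 2 ^ k - n = real_of_int j / 2 ^ k"
      by (simp_all add: field_simps)
    ultimately show ?thesis using k unfolding small_increments_def by metis
  qed
  define j where "j = \<lfloor>x * 2 ^ k\<rfloor>"
  have jx: "real_of_int j / 2 ^ k \<le> x" "x < real_of_int j / 2 ^ k + 1 / 2 ^ k"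
    using dyadic_floor_le[of k x] dyadic_floor_gt[of x k] by (simp_all add: dyadic_floor_def j_def)
  have p1: "(1::real) \<le> 2 ^ k" by simp
  have "- (real n - 2) * 2 ^ k \<le> x * 2 ^ k" "x * 2 ^ k \<le> (real n - 2) * 2 ^ k"
    using n by (intro mult_right_mono; simp)+
  then have bnd: "- (real n * 2 ^ k) + 2 * 2 ^ k \<le> x * 2 ^ k" "x * 2 ^ k \<le> real n * 2 ^ k - 2 * 2 ^ k"
    by (simp_all add: algebra_simps)
  have "x * 2 ^ k - 1 < real_of_int j" "real_of_int j \<le> x * 2 ^ k" unfolding j_def by linarith+
  then have "- (real n * 2 ^ k) \<le> real_of_int j - 1" "real_of_int j + 1 < real n * 2 ^ k"
    using bnd p1 by linarith+
  then have "real_of_int (- int n * 2 ^ k) \<le> real_of_int (j - 1)" "real_of_int (j + 1) < real_of_int (int n * 2 ^ k)"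
    by simp_all
  then have jn: "- int n * 2 ^ k \<le> j - 1" "j + 1 < int n * 2 ^ k" by linarith+
  have i1: "g (real_of_int j / 2 ^ k) - g (real_of_int (j - 1) / 2 ^ k) < 1 / (real m + 1)" using inc[of "j - 1"] jn by simp
  have i2: "g (real_of_int (j + 1) / 2 ^ k) - g (real_of_int j / 2 ^ k) < 1 / (real m + 1)" using inc[of j] jn by simp
  have i3: "g (real_of_int (j + 2) / 2 ^ k) - g (real_of_int (j + 1) / 2 ^ k) < 1 / (real m + 1)" using inc[of "j + 1"] jn
    by (simp add: add.assoc)
  have x1: "g (real_of_int j / 2 ^ k) \<le> dyadic_limit g x" using jx by (intro dyadic_limit_ge g)
  have x2: "dyadic_limit g x \<le> g (real_of_int (j + 1) / 2 ^ k)"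
    using jx by (intro dyadic_limit_tendsto(3) g) (simp add: add_divide_distrib)
  show "\<exists>d>0. \<forall>y. dist y x < d \<longrightarrow> dist (dyadic_limit g y) (dyadic_limit g x) < e"
  proof (intro exI[of _ "1 / 2 ^ k"] conjI allI impI)
    fix y assume y: "dist y x < 1 / 2 ^ k"
    have "g (real_of_int (j - 1) / 2 ^ k) \<le> dyadic_limit g y"
      using y jx by (intro dyadic_limit_ge g) (simp add: dist_real_def diff_divide_distrib)
    moreover have "dyadic_limit g y \<le> g (real_of_int (j + 2) / 2 ^ k)"
    proof (intro dyadic_limit_tendsto(3) g)
      have "real_of_int (j + 2) / 2 ^ k = real_of_int j / 2 ^ k + 2 * (1 / 2 ^ k)" by (simp add: add_divide_distrib)
      then show "y \<le> real_of_int (j + 2) / 2 ^ k" using y jx unfolding dist_real_def by linarith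
    qed
    ultimately show "dist (dyadic_limit g y) (dyadic_limit g x) < e"
      using i1 i2 i3 x1 x2 em unfolding dist_real_def by linarith
  qed simp
qed

lemma dyadic_mono_abs_bound:
  assumes g: "dyadic_mono g" and "- real n \<le> dyadic_floor k x" "dyadic_floor k x \<le> real n"
  shows "\<bar>g (dyadic_floor k x)\<bar> \<le> \<bar>g (- real n)\<bar> + \<bar>g (real n)\<bar>"
proof -
  have "g (real_of_int (- int n) / 2 ^ 0) \<le> g (dyadic_floor k x)"
    using assms(2) unfolding dyadic_floor_def by (intro dyadic_mono_le[OF g]) simp
  moreover have "g (dyadic_floor k x) \<le> g (real_of_int (int n) / 2 ^ 0)"
    using assms(3) unfolding dyadic_floor_def by (intro dyadic_mono_le[OF g]) simp
  ultimately show ?thesis by simp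
qed

section \<open>Integral representation\<close>

locale additive_functional =
  fixes M :: "'a measure" and V :: "('a \<Rightarrow> real) \<Rightarrow> real" and N :: "'a set set"
  assumes space_M: "space M = UNIV"
    and V_cont: "\<And>fs f B. (\<And>n. fs n \<in> Linf M) \<Longrightarrow> f \<in> Linf M \<Longrightarrow> (\<And>n \<omega>. \<bar>fs n \<omega>\<bar> \<le> B) \<Longrightarrow>
      (\<And>\<omega>. (\<lambda>n. fs n \<omega>) \<longlonglongrightarrow> f \<omega>) \<Longrightarrow> (\<lambda>n. V (fs n)) \<longlonglongrightarrow> V f"
    and V_zero: "V (\<lambda>_. 0) = 0"
    and V_split: "\<And>D f h. D \<in> sets M \<Longrightarrow> f \<in> Linf M \<Longrightarrow> h \<in> Linf M \<Longrightarrow>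
      V (mix D f h) = V (mix D f (\<lambda>_. 0)) + V (mix (- D) h (\<lambda>_. 0))"
    and V_less: "\<And>D x y. D \<in> sets M - N \<Longrightarrow> x < y \<Longrightarrow> V (mix D (\<lambda>_. x) (\<lambda>_. 0)) < V (mix D (\<lambda>_. y) (\<lambda>_. 0))"
    and V_null: "\<And>D x. D \<in> N \<Longrightarrow> V (mix D (\<lambda>_. x) (\<lambda>_. 0)) = 0"
    and N_sets: "N \<subseteq> sets M" and nontrivial: "UNIV \<notin> N"
begin

definition V_on :: "('a \<Rightarrow> real) \<Rightarrow> 'a set \<Rightarrow> real" where
  "V_on f D = V (mix D f (\<lambda>_. 0))"

lemma UNIV_sets [simp]: "UNIV \<in> sets M"
  using sets.top[of M] space_M by simp

lemma V_on_empty [simp]: "V_on f {} = 0"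
  by (simp add: V_on_def mix_def V_zero)

lemma V_on_zero [simp]: "V_on (\<lambda>_. 0) D = 0"
  by (simp add: V_on_def mix_def V_zero)

lemma V_on_Un:
  assumes "D \<in> sets M" "D' \<in> sets M" "D \<inter> D' = {}" "f \<in> Linf M"
  shows "V_on f (D \<union> D') = V_on f D + V_on f D'"
proof -
  have "mix (D \<union> D') f (\<lambda>_. 0) = mix D f (mix D' f (\<lambda>_. 0))" by (auto simp: mix_def fun_eq_iff)
  moreover have "mix (- D) (mix D' f (\<lambda>_. 0)) (\<lambda>_. 0) = mix D' f (\<lambda>_. 0)"
    using assms(3) by (auto simp: mix_def fun_eq_iff)
  ultimately show ?thesis using V_split[OF assms(1,4), of "mix D' f (\<lambda>_. 0)"] assms by (simp add: V_on_def)
qed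

lemma V_on_sum:
  assumes "finite I" "\<And>i. i \<in> I \<Longrightarrow> D i \<in> sets M" "disjoint_family_on D I" "f \<in> Linf M"
  shows "V_on f (\<Union>i\<in>I. D i) = (\<Sum>i\<in>I. V_on f (D i))"
  using assms(1-3)
proof (induction I)
  case (insert i I)
  have "V_on f (D i \<union> (\<Union>i\<in>I. D i)) = V_on f (D i) + V_on f (\<Union>i\<in>I. D i)"
    using insert assms(4) by (intro V_on_Un) (auto simp: disjoint_family_on_def)
  then show ?case using insert by (simp add: disjoint_family_on_def)
qed simp

text \<open>The acts cut off at finite unions converge pointwise and stay bounded, so continuity of
  \<open>V\<close> upgrades finite to countable additivity.\<close>

lemma V_on_sums:
  assumes D: "range D \<subseteq> sets M" "disjoint_family D" and f: "f \<in> Linf M"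
  shows "(\<lambda>i::nat. V_on f (D i)) sums V_on f (\<Union>i. D i)"
proof -
  obtain B where B: "B > 0" "\<And>\<omega>. \<bar>f \<omega>\<bar> \<le> B" using Linf_bound[OF f] by auto
  have s: "(\<Union>i<n. D i) \<in> sets M" "(\<Union>i. D i) \<in> sets M" for n :: nat using D(1) by auto
  have "(\<lambda>n. V (mix (\<Union>i<n. D i) f (\<lambda>_. 0))) \<longlonglongrightarrow> V (mix (\<Union>i. D i) f (\<lambda>_. 0))"
  proof (rule V_cont)
    fix \<omega>
    show "(\<lambda>n. mix (\<Union>i<n. D i) f (\<lambda>_. 0) \<omega>) \<longlonglongrightarrow> mix (\<Union>i. D i) f (\<lambda>_. 0) \<omega>"
    proof (cases "\<exists>i. \<omega> \<in> D i")
      case True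
      then obtain i where i: "\<omega> \<in> D i" by blast
      have "mix (\<Union>i<n. D i) f (\<lambda>_. 0) \<omega> = mix (\<Union>i. D i) f (\<lambda>_. 0) \<omega>" if "n \<ge> Suc i" for n
        using i that by (auto simp: mix_def)
      then show ?thesis by (intro tendsto_eventually) (metis (mono_tags, lifting) eventually_sequentially)
    next
      case False then show ?thesis by (simp add: mix_def)
    qed
  next
    fix n \<omega> show "\<bar>mix (\<Union>i<n. D i) f (\<lambda>_. 0) \<omega>\<bar> \<le> B" using B by (auto simp: mix_def)
  qed (use s f in auto)
  moreover have "V (mix (\<Union>i<n. D i) f (\<lambda>_. 0)) = (\<Sum>i<n. V_on f (D i))" for n
    using V_on_sum[of "{..<n}" D f] D f by (auto simp: V_on_def disjoint_family_on_def)
  ultimately show ?thesis unfolding sums_def by (simp add: V_on_def)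
qed

lemma V_on_mono: assumes "D \<in> sets M" "x \<le> y" shows "V_on (\<lambda>_. x) D \<le> V_on (\<lambda>_. y) D"
  using V_less[of D x y] V_null[of D x] V_null[of D y] assms
  by (cases "D \<in> N"; cases "x = y") (auto simp: V_on_def)

text \<open>The factor \<open>a\<close> serves two purposes: normalising the set function of
  \<open>1\<close> to total mass one, and making the set function of a negative \<open>x\<close>
  nonnegative.\<close>

lemma measure_exists:
  assumes nonneg: "\<And>D. D \<in> sets M \<Longrightarrow> 0 \<le> a * V_on (\<lambda>_. x) D"
  shows "\<exists>Q. sets Q = sets M \<and> (\<forall>D\<in>sets M. emeasure Q D = ennreal (a * V_on (\<lambda>_. x) D))"
proof -
  let ?\<mu> = "\<lambda>D. ennreal (a * V_on (\<lambda>_. x) D)"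
  have sa: "sigma_algebra UNIV (sets M)" using sets.sigma_algebra_axioms[of M] space_M by simp
  have "countably_additive (sets M) ?\<mu>"
  proof (rule countably_additiveI)
    fix D :: "nat \<Rightarrow> 'a set" assume D: "range D \<subseteq> sets M" "disjoint_family D"
    show "(\<Sum>i. ?\<mu> (D i)) = ?\<mu> (\<Union>i. D i)"
      using D nonneg by (intro suminf_ennreal_eq sums_mult V_on_sums) auto
  qed
  then have "emeasure (measure_of UNIV (sets M) ?\<mu>) D = ?\<mu> D" if "D \<in> sets M" for D
    using that by (intro emeasure_measure_of_sigma sa) (auto simp: positive_def)
  moreover have "sets (measure_of UNIV (sets M) ?\<mu>) = sets M"
    using sigma_algebra.sets_measure_of_eq[OF sa] .
  ultimately show ?thesis by blast
qed

lemma V_on_one_pos: "V_on (\<lambda>_. 1) UNIV > 0"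
  using V_less[of UNIV 0 1] nontrivial by (simp add: V_on_def mix_def V_zero)

text \<open>The probability is the set function of the outcome \<open>1\<close>, normalised. Strict
  monotonicity off \<open>N\<close> and vanishing on \<open>N\<close> identify its null
  events.\<close>

lemma prob_exists:
  "\<exists>P. prob_space P \<and> sets P = sets M \<and> (\<forall>D\<in>sets M. measure P D = 0 \<longleftrightarrow> D \<in> N)"
proof -
  define c where "c = V_on (\<lambda>_. 1) UNIV"
  have c: "c > 0" using V_on_one_pos by (simp add: c_def)
  have nn: "0 \<le> (1 / c) * V_on (\<lambda>_. 1) D" if "D \<in> sets M" for D
    using V_on_mono[OF that, of 0 1] c by simp
  obtain P where P: "sets P = sets M" "\<And>D. D \<in> sets M \<Longrightarrow> emeasure P D = ennreal ((1 / c) * V_on (\<lambda>_. 1) D)"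
    using measure_exists[of "1 / c" 1, OF nn] by blast
  have sp: "space P = UNIV" using sets_eq_imp_space_eq[OF P(1)] space_M by simp
  have "prob_space P" by (rule prob_spaceI) (use P(2)[of UNIV] c in \<open>simp add: sp c_def[symmetric]\<close>)
  moreover have "measure P D = 0 \<longleftrightarrow> D \<in> N" if "D \<in> sets M" for D
  proof -
    have "measure P D = (1 / c) * V_on (\<lambda>_. 1) D" using P(2)[OF that] nn[OF that] by (simp add: measure_def)
    moreover have "V_on (\<lambda>_. 1) D = 0 \<longleftrightarrow> D \<in> N"
    proof
      assume "V_on (\<lambda>_. 1) D = 0"
      then have "\<not> V_on (\<lambda>_. 0) D < V_on (\<lambda>_. 1) D" by simp
      then show "D \<in> N" using V_less[of D 0 1] that unfolding V_on_def by auto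
    qed (use V_null[of D 1] in \<open>simp add: V_on_def\<close>)
    ultimately show ?thesis using c by simp
  qed
  ultimately show ?thesis using P(1) by blast
qed

end

section \<open>Densities for fixed outcomes\<close>

locale additive_functional_prob = additive_functional M V N + prob_space P
  for M :: "'a measure" and V N and P :: "'a measure" +
  assumes sets_P [measurable_cong]: "sets P = sets M"
    and P_null: "\<And>D. D \<in> sets M \<Longrightarrow> measure P D = 0 \<longleftrightarrow> D \<in> N"
begin

lemma space_P: "space P = UNIV"
  using sets_eq_imp_space_eq[OF sets_P] space_M by simp

text \<open>The set function of \<open>x\<close>, times the sign of \<open>x\<close>, is a finite
  measure that vanishes on \<open>N\<close>, so the Radon-Nikodym theorem applies. For
  \<open>x = 0\<close> the zero function itself is demanded, because the utility must vanish at
  \<open>0\<close> in every state.\<close>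

lemma density_exists:
  "\<exists>h. integrable P h \<and> (x = 0 \<longrightarrow> h = (\<lambda>_. 0)) \<and>
     (\<forall>D\<in>sets M. (\<integral>\<omega>. indicator D \<omega> * h \<omega> \<partial>P) = V_on (\<lambda>_. x) D)"
proof (cases "x = 0")
  case True
  then show ?thesis by (intro exI[of _ "\<lambda>_. 0"]) auto
next
  case False
  define s where "s = sgn x"
  have s: "s * s = 1" using False by (simp add: s_def sgn_if)
  have nn: "0 \<le> s * V_on (\<lambda>_. x) D" if "D \<in> sets M" for D
    using V_on_mono[OF that, of 0 x] V_on_mono[OF that, of x 0] False by (auto simp: s_def sgn_if)
  obtain Q where Q: "sets Q = sets M" "\<And>D. D \<in> sets M \<Longrightarrow> emeasure Q D = ennreal (s * V_on (\<lambda>_. x) D)"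
    using measure_exists[of s x, OF nn] by blast
  have spQ: "space Q = UNIV" using sets_eq_imp_space_eq[OF Q(1)] space_M by simp
  have fQ: "finite_measure Q" by (rule finite_measureI) (simp add: spQ Q(2))
  have ac: "absolutely_continuous P Q"
    unfolding absolutely_continuous_def
  proof
    fix D assume "D \<in> null_sets P"
    then have D: "D \<in> sets M" "measure P D = 0" using sets_P by (auto simp: null_sets_def measure_def)
    then have "D \<in> N" using P_null by blast
    then have "V_on (\<lambda>_. x) D = 0" using V_null by (simp add: V_on_def)
    then show "D \<in> null_sets Q" using D Q by (auto simp: null_sets_def)
  qed
  have sQP: "sets Q = sets P" using Q(1) sets_P by simp
  obtain d where d: "d \<in> borel_measurable P" "AE \<omega> in P. RN_deriv P Q \<omega> = ennreal (d \<omega>)" "\<And>\<omega>. 0 \<le> d \<omega>"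
    using real_RN_deriv[OF fQ ac sQP] by blast
  note [measurable] = d(1)
  have nnD: "(\<integral>\<^sup>+\<omega>. ennreal (indicator D \<omega> * d \<omega>) \<partial>P) = ennreal (s * V_on (\<lambda>_. x) D)" if D: "D \<in> sets M" for D
  proof -
    have [measurable]: "D \<in> sets P" using D sets_P by simp
    have "ennreal (s * V_on (\<lambda>_. x) D) = emeasure (density P (RN_deriv P Q)) D"
      using Q(2)[OF D] density_RN_deriv[OF ac sQP] by simp
    also have "\<dots> = (\<integral>\<^sup>+\<omega>. RN_deriv P Q \<omega> * indicator D \<omega> \<partial>P)" by (rule emeasure_density) auto
    also have "\<dots> = (\<integral>\<^sup>+\<omega>. ennreal (indicator D \<omega> * d \<omega>) \<partial>P)"
      using d(2) by (intro nn_integral_cong_AE) (auto simp: indicator_def)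
    finally show ?thesis by simp
  qed
  have int: "integrable P d"
    using nnD[of UNIV] d(3) by (intro integrableI_nonneg) auto
  have intD: "(\<integral>\<omega>. indicator D \<omega> * d \<omega> \<partial>P) = s * V_on (\<lambda>_. x) D" if D: "D \<in> sets M" for D
  proof -
    have [measurable]: "D \<in> sets P" using D sets_P by simp
    have "(\<integral>\<omega>. indicator D \<omega> * d \<omega> \<partial>P) = enn2real (\<integral>\<^sup>+\<omega>. ennreal (indicator D \<omega> * d \<omega>) \<partial>P)"
      by (rule integral_eq_nn_integral) (auto simp: d(3))
    then show ?thesis using nnD[OF D] nn[OF D] by simp
  qed
  have "(\<integral>\<omega>. indicator D \<omega> * (s * d \<omega>) \<partial>P) = V_on (\<lambda>_. x) D" if D: "D \<in> sets M" for D
  proof -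
    have "(\<integral>\<omega>. indicator D \<omega> * (s * d \<omega>) \<partial>P) = (\<integral>\<omega>. s * (indicator D \<omega> * d \<omega>) \<partial>P)" by (simp add: ac_simps)
    also have "\<dots> = s * (s * V_on (\<lambda>_. x) D)" using intD[OF D] by simp
    also have "\<dots> = V_on (\<lambda>_. x) D" using s by (simp add: mult.assoc[symmetric])
    finally show ?thesis .
  qed
  then show ?thesis using int False by (intro exI[of _ "\<lambda>\<omega>. s * d \<omega>"]) auto
qed

end

locale density_family = additive_functional_prob +
  fixes h :: "real \<Rightarrow> 'a \<Rightarrow> real"
  assumes h_int: "\<And>x. integrable P (h x)" and h_zero: "h 0 = (\<lambda>_. 0)"
    and h_density: "\<And>x D. D \<in> sets M \<Longrightarrow> (\<integral>\<omega>. indicator D \<omega> * h x \<omega> \<partial>P) = V_on (\<lambda>_. x) D"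
begin

lemma h_measurable [measurable]: "h x \<in> borel_measurable M"
  using borel_measurable_integrable[OF h_int] sets_P measurable_cong_sets by blast

lemma int_indicator:
  assumes "D \<in> sets M" shows "integrable P (\<lambda>\<omega>. indicator D \<omega> * h x \<omega>)"
  using integrable_mult_indicator[of D P "h x"] assms sets_P h_int by simp

text \<open>On the event where the inequality fails, integration would rank \<open>y\<close> no
  higher than \<open>x\<close>, which strict monotonicity of \<open>V\<close> permits only for
  members of \<open>N\<close>.\<close>

lemma AE_h_less:
  assumes "x < y"
  shows "AE \<omega> in P. h x \<omega> < h y \<omega>"
proof -
  define D where "D = {\<omega>. h y \<omega> \<le> h x \<omega>}"
  have "{\<omega> \<in> space M. h y \<omega> \<le> h x \<omega>} \<in> sets M" by measurable
  then have D: "D \<in> sets M" by (simp add: D_def space_M)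
  have "(\<integral>\<omega>. indicator D \<omega> * h y \<omega> \<partial>P) \<le> (\<integral>\<omega>. indicator D \<omega> * h x \<omega> \<partial>P)"
    by (intro integral_mono int_indicator D) (auto simp: D_def indicator_def)
  then have "V_on (\<lambda>_. y) D \<le> V_on (\<lambda>_. x) D" using h_density[OF D] by simp
  then have "D \<in> N" using V_less[of D x y] D assms unfolding V_on_def by force
  then have "emeasure P D = 0" using P_null[OF D] by (simp add: emeasure_eq_measure)
  then show ?thesis
    by (intro AE_I[of _ _ D]) (auto simp: D_def space_P not_less sets_P D[unfolded D_def])
qed

lemma V_simple:
  assumes f: "f \<in> Linf M" and fin: "finite (range f)"
  shows "integrable P (\<lambda>\<omega>. h (f \<omega>) \<omega>)" and "V f = (\<integral>\<omega>. h (f \<omega>) \<omega> \<partial>P)"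
proof -
  define D where "D x = {\<omega>. f \<omega> = x}" for x
  have [measurable]: "f \<in> borel_measurable M" using f by (simp add: Linf_def)
  have "{\<omega> \<in> space M. f \<omega> = x} \<in> sets M" for x by measurable
  then have D: "D x \<in> sets M" for x by (simp add: D_def space_M)
  have eq: "h (f \<omega>) \<omega> = (\<Sum>x\<in>range f. indicator (D x) \<omega> * h x \<omega>)" for \<omega>
  proof -
    have "(\<Sum>x\<in>range f. indicator (D x) \<omega> * h x \<omega>) = (\<Sum>x\<in>range f. if x = f \<omega> then h x \<omega> else 0)"
      by (intro sum.cong) (auto simp: D_def indicator_def)
    also have "\<dots> = h (f \<omega>) \<omega>" using fin by simp
    finally show ?thesis by simp
  qed
  show "integrable P (\<lambda>\<omega>. h (f \<omega>) \<omega>)" unfolding eq by (intro Bochner_Integration.integrable_sum int_indicator D)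
  have "(\<Union>x\<in>range f. D x) = UNIV" by (auto simp: D_def)
  then have "V f = V_on f (\<Union>x\<in>range f. D x)" by (simp add: V_on_def mix_def)
  also have "\<dots> = (\<Sum>x\<in>range f. V_on f (D x))"
    using D f fin by (intro V_on_sum) (auto simp: disjoint_family_on_def D_def)
  also have "\<dots> = (\<Sum>x\<in>range f. V_on (\<lambda>_. x) (D x))"
  proof (rule sum.cong)
    fix x
    have "mix (D x) f (\<lambda>_. 0) = mix (D x) (\<lambda>_. x) (\<lambda>_. 0)" by (auto simp: mix_def D_def fun_eq_iff)
    then show "V_on f (D x) = V_on (\<lambda>_. x) (D x)" by (simp add: V_on_def)
  qed simp
  also have "\<dots> = (\<Sum>x\<in>range f. \<integral>\<omega>. indicator (D x) \<omega> * h x \<omega> \<partial>P)" using h_density D by simp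
  also have "\<dots> = (\<integral>\<omega>. h (f \<omega>) \<omega> \<partial>P)"
    unfolding eq by (intro Bochner_Integration.integral_sum[symmetric] int_indicator D)
  finally show "V f = (\<integral>\<omega>. h (f \<omega>) \<omega> \<partial>P)" .
qed

section \<open>States whose densities are monotone and free of jumps\<close>

definition "monotone_states = {\<omega>. dyadic_mono (\<lambda>q. h q \<omega>)}"

lemma monotone_states_sets [measurable]: "monotone_states \<in> sets M"
proof -
  have "{\<omega> \<in> space M. \<forall>(k::nat) (i::int) (j::int). i < j \<longrightarrow> h (real_of_int i / 2 ^ k) \<omega> < h (real_of_int j / 2 ^ k) \<omega>} \<in> sets M"
    by measurable
  then show ?thesis by (simp add: monotone_states_def dyadic_mono_def space_M)
qed

lemma AE_monotone_states: "AE \<omega> in P. \<omega> \<in> monotone_states"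
proof -
  have "AE \<omega> in P. i < j \<longrightarrow> h (real_of_int i / 2 ^ k) \<omega> < h (real_of_int j / 2 ^ k) \<omega>" for k :: nat and i j :: int
    using AE_h_less[of "real_of_int i / 2 ^ k" "real_of_int j / 2 ^ k"]
    by (cases "i < j") (auto simp: divide_strict_right_mono)
  then show ?thesis unfolding monotone_states_def dyadic_mono_def by (simp add: AE_all_countable)
qed

text \<open>At every level some grid interval of \<open>[- n, n]\<close> keeps an increment of at
  least \<open>1 / (real m + 1)\<close>. With \<open>n\<close> and \<open>m\<close> natural numbers,
  the union over all of them stays null.\<close>

definition "jump_states n m = {\<omega> \<in> monotone_states. \<forall>k. \<not> small_increments (\<lambda>q. h q \<omega>) n m k}"

lemma jump_states_sets [measurable]: "jump_states n m \<in> sets M"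
proof -
  have "{\<omega> \<in> space M. \<omega> \<in> monotone_states \<and> (\<forall>k. \<not> (\<forall>i<2 * n * 2 ^ k.
      h (real (Suc i) / 2 ^ k - n) \<omega> - h (real i / 2 ^ k - n) \<omega> < 1 / (real m + 1)))} \<in> sets M"
    by measurable
  then show ?thesis by (simp add: jump_states_def small_increments_def space_M)
qed

lemma jump_states_null: "measure P (jump_states n m) = 0"
proof -
  define J where "J = jump_states n m"
  have J [measurable]: "J \<in> sets M" unfolding J_def by measurable
  define e where "e = 1 / (real m + 1)"
  have e: "e > 0" by (simp add: e_def)
  define pt where "pt k i = real i / 2 ^ k - real n" for k i :: nat
  define big where "big k i \<omega> \<longleftrightarrow> i < 2 * n * 2 ^ k \<and> e \<le> h (pt k (Suc i)) \<omega> - h (pt k i) \<omega>" for k i \<omega>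
  have [measurable]: "Measurable.pred M (big k i)" for k i unfolding big_def by measurable
  \<comment> \<open>The leftmost dyadic interval of level \<open>k\<close> with a big increment moves to the right as \<open>k\<close> grows,
    so both of its end points converge to the same act.\<close>
  define I where "I k \<omega> = (LEAST i. big k i \<omega>)" for k \<omega>
  have I_meas [measurable]: "I k \<in> measurable M (count_space UNIV)" for k unfolding I_def by measurable
  have bigI: "big k (I k \<omega>) \<omega>" if "\<omega> \<in> J" for k \<omega>
  proof -
    have "\<not> small_increments (\<lambda>q. h q \<omega>) n m k" using that by (simp add: J_def jump_states_def)
    then have "\<exists>i. big k i \<omega>" unfolding small_increments_def big_def pt_def e_def by (auto simp: not_less)
    then show ?thesis unfolding I_def by (rule LeastI_ex)
  qed
  have mono_h: "h (real i / 2 ^ k - n) \<omega> \<le> h (real j / 2 ^ l - n) \<omega>"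
    if "\<omega> \<in> J" "real i / 2 ^ k \<le> real j / 2 ^ l" for i k j l \<omega>
  proof -
    have d: "real i / 2 ^ k - n = real_of_int (int i - int n * 2 ^ k) / 2 ^ k" for i k :: nat
      by (simp add: diff_divide_distrib)
    have g: "dyadic_mono (\<lambda>q. h q \<omega>)" using that(1) by (simp add: J_def jump_states_def monotone_states_def)
    have "real i / 2 ^ k - n \<le> real j / 2 ^ l - n" using that(2) by simp
    then show ?thesis unfolding d by (rule dyadic_mono_le[OF g])
  qed
  have I_Suc: "pt k (I k \<omega>) \<le> pt (Suc k) (I (Suc k) \<omega>)" if \<omega>: "\<omega> \<in> J" for k \<omega>
  proof -
    define i where "i = I (Suc k) \<omega>"
    have b: "i < 2 * n * 2 ^ Suc k" "e \<le> h (pt (Suc k) (Suc i)) \<omega> - h (pt (Suc k) i) \<omega>"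
      using bigI[OF \<omega>, of "Suc k"] by (auto simp: i_def big_def)
    \<comment> \<open>Interval \<open>i\<close> of level \<open>Suc k\<close> lies in interval
      \<open>i div 2\<close> of level \<open>k\<close>, whose increment is at least as large by
      monotonicity. The leftmost big interval of level \<open>k\<close> therefore starts no further
      to the right.\<close>
    have i2: "2 * (i div 2) \<le> i" "Suc i \<le> 2 * Suc (i div 2)" by auto
    have r: "real (2 * a) / 2 ^ Suc k = real a / 2 ^ k" for a by simp
    have 1: "real (i div 2) / 2 ^ k \<le> real i / 2 ^ Suc k"
      unfolding r[symmetric] using i2(1) by (intro divide_right_mono of_nat_mono) auto
    have 2: "real (Suc i) / 2 ^ Suc k \<le> real (Suc (i div 2)) / 2 ^ k"
      unfolding r[symmetric] using i2(2) by (intro divide_right_mono of_nat_mono) auto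
    have "h (pt k (i div 2)) \<omega> \<le> h (pt (Suc k) i) \<omega>" unfolding pt_def by (rule mono_h[OF \<omega> 1])
    moreover have "h (pt (Suc k) (Suc i)) \<omega> \<le> h (pt k (Suc (i div 2))) \<omega>" unfolding pt_def by (rule mono_h[OF \<omega> 2])
    moreover have "i div 2 < 2 * n * 2 ^ k" using b(1) by simp
    ultimately have "big k (i div 2) \<omega>" using b(2) unfolding big_def by linarith
    then have "I k \<omega> \<le> i div 2" unfolding I_def by (rule Least_le)
    then have "real (I k \<omega>) / 2 ^ k \<le> real (i div 2) / 2 ^ k" by (intro divide_right_mono of_nat_mono) auto
    then show ?thesis using 1 unfolding pt_def i_def by linarith
  qed
  have pt_bound: "\<bar>pt k i\<bar> \<le> n" if "i \<le> 2 * n * 2 ^ k" for k i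
  proof -
    have "real i \<le> real (2 * n * 2 ^ k)" using that by (rule of_nat_mono)
    then have "real i / 2 ^ k \<le> 2 * n" by (simp add: divide_le_eq)
    moreover have "0 \<le> real i / 2 ^ k" by simp
    ultimately show ?thesis unfolding pt_def by linarith
  qed
  define F where "F k \<omega> = (if \<omega> \<in> J then pt k (I k \<omega>) else 0)" for k \<omega>
  define G where "G k \<omega> = (if \<omega> \<in> J then pt k (Suc (I k \<omega>)) else 0)" for k \<omega>
  have Fb: "\<bar>F k \<omega>\<bar> \<le> n" for k \<omega>
    using bigI[of \<omega> k] pt_bound[of "I k \<omega>" k] by (auto simp: F_def big_def)
  have Gb: "\<bar>G k \<omega>\<bar> \<le> n" for k \<omega>
    using bigI[of \<omega> k] pt_bound[of "Suc (I k \<omega>)" k] by (auto simp: G_def big_def)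
  have Fm [measurable]: "F k \<in> borel_measurable M" for k unfolding F_def pt_def by measurable
  have Gm [measurable]: "G k \<in> borel_measurable M" for k unfolding G_def pt_def by measurable
  have FL: "F k \<in> Linf M" for k by (rule LinfI[OF Fm Fb])
  have GL: "G k \<in> Linf M" for k by (rule LinfI[OF Gm Gb])
  have Ff: "finite (range (F k))" for k
  proof (rule finite_subset)
    show "range (F k) \<subseteq> insert 0 (pt k ` {..2 * n * 2 ^ k})"
      using bigI[of _ k] by (force simp: F_def big_def)
  qed simp
  have Gf: "finite (range (G k))" for k
  proof (rule finite_subset)
    show "range (G k) \<subseteq> insert 0 (pt k ` {..2 * n * 2 ^ k})"
      using bigI[of _ k] by (force simp: G_def big_def)
  qed simp
  have inc: "incseq (\<lambda>k. F k \<omega>)" for \<omega>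
    by (rule incseq_SucI) (use I_Suc[of \<omega>] in \<open>auto simp: F_def\<close>)
  have "\<exists>l. (\<lambda>k. F k \<omega>) \<longlonglongrightarrow> l" for \<omega>
    using incseq_convergent[OF inc, of \<omega> "real n"] Fb[of _ \<omega>] by (metis abs_le_D1)
  then obtain L where L: "\<And>\<omega>. (\<lambda>k. F k \<omega>) \<longlonglongrightarrow> L \<omega>" by metis
  have LL: "L \<in> Linf M"
  proof (rule LinfI)
    show "L \<in> borel_measurable M" by (rule borel_measurable_LIMSEQ_real[OF L Fm])
    show "\<bar>L \<omega>\<bar> \<le> n" for \<omega> using LIMSEQ_le_const2[OF tendsto_rabs[OF L]] Fb by blast
  qed
  have GF: "G k \<omega> = F k \<omega> + (if \<omega> \<in> J then 1 / 2 ^ k else 0)" for k \<omega>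
    by (simp add: F_def G_def pt_def add_divide_distrib)
  have "(\<lambda>k. if \<omega> \<in> J then 1 / 2 ^ k else 0 :: real) \<longlonglongrightarrow> 0" for \<omega>
    using inverse_power2_lim by (cases "\<omega> \<in> J") auto
  from tendsto_add[OF L this] have LG: "(\<lambda>k. G k \<omega>) \<longlonglongrightarrow> L \<omega>" for \<omega> unfolding GF by simp
  have "(\<lambda>k. V (G k) - V (F k)) \<longlonglongrightarrow> V L - V L"
    by (intro tendsto_diff V_cont[OF GL LL Gb LG] V_cont[OF FL LL Fb L])
  then have lim: "(\<lambda>k. V (G k) - V (F k)) \<longlonglongrightarrow> 0" by simp
  \<comment> \<open>On \<open>J\<close> the two densities differ by at least \<open>e\<close> at the
    end points of the selected interval, while off \<open>J\<close> both acts are \<open>0\<close>.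
    The bound is uniform in \<open>k\<close>, whereas the right-hand side tends to
    \<open>0\<close>.\<close>
  have "e * measure P J \<le> V (G k) - V (F k)" for k
  proof -
    have JP: "J \<in> sets P" using J sets_P by simp
    have "e * measure P J = (\<integral>\<omega>. e * indicator J \<omega> \<partial>P)" using JP by simp
    also have "\<dots> \<le> (\<integral>\<omega>. h (G k \<omega>) \<omega> - h (F k \<omega>) \<omega> \<partial>P)"
    proof (rule integral_mono)
      show "integrable P (\<lambda>\<omega>. e * indicator J \<omega>)" using JP by (simp add: emeasure_eq_measure)
      show "integrable P (\<lambda>\<omega>. h (G k \<omega>) \<omega> - h (F k \<omega>) \<omega>)"
        by (intro Bochner_Integration.integrable_diff V_simple GL Gf FL Ff)
      fix \<omega> show "e * indicator J \<omega> \<le> h (G k \<omega>) \<omega> - h (F k \<omega>) \<omega>"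
        using bigI[of \<omega> k] by (auto simp: indicator_def F_def G_def big_def)
    qed
    also have "\<dots> = V (G k) - V (F k)"
      using V_simple[OF GL Gf] V_simple[OF FL Ff] by simp
    finally show ?thesis .
  qed
  then have "e * measure P J \<le> 0" using LIMSEQ_le_const[OF lim] by blast
  then have "measure P J \<le> 0" using e by (simp add: mult_le_0_iff)
  then show ?thesis unfolding J_def by (simp add: measure_le_0_iff)
qed

definition "regular_states = monotone_states - (\<Union>n m. jump_states n m)"

lemma regular_states_sets [measurable]: "regular_states \<in> sets M"
  unfolding regular_states_def by measurable

lemma AE_regular_states: "AE \<omega> in P. \<omega> \<in> regular_states"
proof -
  have "AE \<omega> in P. \<omega> \<notin> jump_states n m" for n m
    using jump_states_null[of n m]
    by (intro AE_not_in) (auto simp: null_sets_def emeasure_eq_measure sets_P)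
  then have "AE \<omega> in P. \<forall>n m. \<omega> \<notin> jump_states n m" by (simp add: AE_all_countable)
  with AE_monotone_states show ?thesis by eventually_elim (auto simp: regular_states_def)
qed

text \<open>Regularity is required in every state, so the identity in \<open>x\<close> serves as a
  default on the null set of irregular states.\<close>

definition "utility \<omega> x = (if \<omega> \<in> regular_states then dyadic_limit (\<lambda>q. h q \<omega>) x else x)"

lemma regular_dyadic_mono: "\<omega> \<in> regular_states \<Longrightarrow> dyadic_mono (\<lambda>q. h q \<omega>)"
  by (simp add: regular_states_def monotone_states_def)

lemma utility_regular: "F_regular M utility"
  unfolding F_regular_def
proof (intro conjI allI)
  fix \<omega>
  show "continuous_on UNIV (utility \<omega>)"
  proof (cases "\<omega> \<in> regular_states")
    case True
    then have "\<exists>k. small_increments (\<lambda>q. h q \<omega>) n m k" for n m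
      by (auto simp: regular_states_def jump_states_def)
    then show ?thesis
      using dyadic_limit_continuous[OF regular_dyadic_mono[OF True]] True by (simp add: utility_def[abs_def])
  next
    case False then show ?thesis by (simp add: utility_def[abs_def])
  qed
  show "strict_mono (utility \<omega>)"
  proof (cases "\<omega> \<in> regular_states")
    case True
    then show ?thesis
      using dyadic_limit_strict_mono[OF regular_dyadic_mono[OF True]] by (simp add: utility_def[abs_def])
  next
    case False then show ?thesis by (simp add: utility_def[abs_def] strict_mono_def)
  qed
  show "utility \<omega> 0 = 0"
    using dyadic_limit_dyadic[OF regular_dyadic_mono, of \<omega> 0 0] by (simp add: utility_def h_zero)
next
  show "(\<lambda>(\<omega>, x). utility \<omega> x) \<in> borel_measurable (M \<Otimes>\<^sub>M borel)"
  proof (rule borel_measurable_LIMSEQ_real)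
    fix p :: "'a \<times> real"
    show "(\<lambda>k. if fst p \<in> regular_states then h (dyadic_floor k (snd p)) (fst p) else snd p)
        \<longlonglongrightarrow> (case p of (\<omega>, x) \<Rightarrow> utility \<omega> x)"
      using dyadic_limit_tendsto(1)[OF regular_dyadic_mono, of "fst p" "snd p"]
      by (auto simp: utility_def split: prod.split)
  next
    fix k
    have [measurable]: "(\<lambda>p. h (real_of_int \<lfloor>snd p * 2 ^ k :: real\<rfloor> / 2 ^ k) (fst p)) \<in> borel_measurable (M \<Otimes>\<^sub>M borel)"
      by (rule measurable_compose_countable[of "\<lambda>j p. h (real_of_int j / 2 ^ k) (fst p)" _ _ "\<lambda>p. \<lfloor>snd p * 2 ^ k :: real\<rfloor>"])
        measurable
    show "(\<lambda>p. if fst p \<in> regular_states then h (dyadic_floor k (snd p)) (fst p) else snd p)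
        \<in> borel_measurable (M \<Otimes>\<^sub>M borel)"
      unfolding dyadic_floor_def by measurable
  qed
qed

lemma V_eq_integral:
  assumes f: "f \<in> Linf M"
  shows "integrable P (\<lambda>\<omega>. utility \<omega> (f \<omega>))" and "V f = (\<integral>\<omega>. utility \<omega> (f \<omega>) \<partial>P)"
proof -
  obtain B where B: "\<And>\<omega>. \<bar>f \<omega>\<bar> \<le> B" using Linf_bound[OF f] by auto
  \<comment> \<open>Rounding changes the absolute value by at most \<open>1\<close>, so all
    approximations stay in \<open>[- n, n]\<close>; by monotonicity the densities at the two end
    points then supply an integrable bound for dominated convergence.\<close>
  obtain n :: nat where n: "B + 1 < n" using reals_Archimedean2 by blast
  define fk where "fk k \<omega> = dyadic_floor k (f \<omega>)" for k \<omega>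
  have fL: "fk k \<in> Linf M" and ff: "finite (range (fk k))" for k
    unfolding fk_def using dyadic_floor_Linf[OF f] by auto
  have fb: "\<bar>fk k \<omega>\<bar> \<le> n" for k \<omega>
    using dyadic_floor_abs[of k "f \<omega>"] B[of \<omega>] n unfolding fk_def by linarith
  have um: "(\<lambda>\<omega>. utility \<omega> (f \<omega>)) \<in> borel_measurable P"
  proof -
    have [measurable]: "f \<in> borel_measurable M" using f by (simp add: Linf_def)
    have [measurable]: "(\<lambda>(\<omega>, x). utility \<omega> x) \<in> borel_measurable (M \<Otimes>\<^sub>M borel)"
      using utility_regular unfolding F_regular_def by blast
    have "(\<lambda>\<omega>. (\<lambda>(\<omega>, x). utility \<omega> x) (\<omega>, f \<omega>)) \<in> borel_measurable M" by measurable
    then show ?thesis using measurable_cong_sets[OF sets_P refl] by simp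
  qed
  have lim: "AE \<omega> in P. (\<lambda>k. h (fk k \<omega>) \<omega>) \<longlonglongrightarrow> utility \<omega> (f \<omega>)"
    using AE_regular_states
  proof eventually_elim
    case (elim \<omega>)
    then show ?case using dyadic_limit_tendsto(1)[OF regular_dyadic_mono[OF elim]] by (simp add: utility_def fk_def)
  qed
  have dom: "AE \<omega> in P. norm (h (fk k \<omega>) \<omega>) \<le> \<bar>h (- real n) \<omega>\<bar> + \<bar>h (real n) \<omega>\<bar>" for k
    using AE_regular_states
  proof eventually_elim
    case (elim \<omega>)
    then show ?case
      using dyadic_mono_abs_bound[OF regular_dyadic_mono[OF elim], of n k "f \<omega>"] fb[of k \<omega>]
      by (simp add: fk_def abs_le_iff)
  qed
  have w: "integrable P (\<lambda>\<omega>. \<bar>h (- real n) \<omega>\<bar> + \<bar>h (real n) \<omega>\<bar>)"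
    by (intro Bochner_Integration.integrable_add integrable_abs h_int)
  have hm: "(\<lambda>\<omega>. h (fk k \<omega>) \<omega>) \<in> borel_measurable P" for k
    using V_simple(1)[OF fL ff] by (rule borel_measurable_integrable)
  show "integrable P (\<lambda>\<omega>. utility \<omega> (f \<omega>))"
    by (rule integrable_dominated_convergence[OF um hm w lim dom])
  have "(\<lambda>k. \<integral>\<omega>. h (fk k \<omega>) \<omega> \<partial>P) \<longlonglongrightarrow> (\<integral>\<omega>. utility \<omega> (f \<omega>) \<partial>P)"
    by (rule integral_dominated_convergence[OF um hm w lim dom])
  then have "(\<lambda>k. V (fk k)) \<longlonglongrightarrow> (\<integral>\<omega>. utility \<omega> (f \<omega>) \<partial>P)" using V_simple(2)[OF fL ff] by simp
  moreover have "(\<lambda>k. V (fk k)) \<longlonglongrightarrow> V f"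
    by (rule V_cont[OF fL f fb]) (simp add: fk_def dyadic_floor_lim)
  ultimately show "V f = (\<integral>\<omega>. utility \<omega> (f \<omega>) \<partial>P)" using LIMSEQ_unique by blast
qed

end

lemma (in additive_functional) integral_representation:
  "\<exists>P u. prob_space P \<and> sets P = sets M \<and> (\<forall>D\<in>sets M. measure P D = 0 \<longleftrightarrow> D \<in> N) \<and> F_regular M u \<and>
     (\<forall>f\<in>Linf M. integrable P (\<lambda>\<omega>. u \<omega> (f \<omega>)) \<and> V f = (\<integral>\<omega>. u \<omega> (f \<omega>) \<partial>P))"
proof -
  obtain P where P: "prob_space P" "sets P = sets M" "\<And>D. D \<in> sets M \<Longrightarrow> measure P D = 0 \<longleftrightarrow> D \<in> N"
    using prob_exists by blast
  interpret prob_space P by fact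
  interpret additive_functional_prob M V N P by unfold_locales (auto simp: P)
  obtain h where h: "\<And>x. integrable P (h x)" "\<And>x. x = 0 \<longrightarrow> h x = (\<lambda>_. 0)"
    "\<And>x. \<forall>D\<in>sets M. (\<integral>\<omega>. indicator D \<omega> * h x \<omega> \<partial>P) = V_on (\<lambda>_. x) D"
    using density_exists by metis
  interpret density_family M V N P h by unfold_locales (use h in auto)
  show ?thesis using P utility_regular V_eq_integral by blast
qed

theorem mainTheorem4:
  fixes M :: "'a measure" and R :: "('a \<Rightarrow> real) \<Rightarrow> ('a \<Rightarrow> real) \<Rightarrow> bool"
  assumes "space M = UNIV"
    and "\<exists>A B C. A \<in> sets M - null_events M R \<and> B \<in> sets M - null_events M R \<and>
                 C \<in> sets M - null_events M R \<and> A \<inter> B = {} \<and> A \<inter> C = {} \<and> B \<inter> C = {}"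
    and "pref_order M R" and "SM M R" and "PC M R" and "ST M R"
  shows "\<exists>P u. prob_space P \<and> sets P = sets M \<and>
           null_events M R = {A \<in> sets M. measure P A = 0} \<and>
           F_regular M u \<and> (\<forall>x. integrable P (\<lambda>\<omega>. u \<omega> x)) \<and>
           (\<forall>f\<in>Linf M. \<forall>g\<in>Linf M.
              R f g \<longleftrightarrow> (\<integral>\<omega>. u \<omega> (f \<omega>) \<partial>P) \<ge> (\<integral>\<omega>. u \<omega> (g \<omega>) \<partial>P))"
proof -
  obtain A B C0 where A: "A \<in> sets M - null_events M R" and B: "B \<in> sets M - null_events M R"
    and C0: "C0 \<in> sets M - null_events M R" and disj: "A \<inter> B = {}" "A \<inter> C0 = {}" "B \<inter> C0 = {}"
    using assms(2) by blast
  have "UNIV \<notin> null_events M R" using null_events_subset[of UNIV M R A] A by auto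
  then interpret preference M R using assms by unfold_locales
  \<comment> \<open>The cells have to cover the whole space. Enlarging the third event to the
    complement of the other two keeps it non-null, since it contains \<open>C0\<close>.\<close>
  define C where "C = - (A \<union> B)"
  have "C \<in> sets M" unfolding C_def using A B by auto
  moreover have "C0 \<subseteq> C" using disj by (auto simp: C_def)
  ultimately have C: "C \<in> sets M - null_events M R" using null_events_subset[of C M R C0] C0 by auto
  have "A \<inter> C = {}" "B \<inter> C = {}" "A \<union> B \<union> C = UNIV" by (auto simp: C_def)
  then obtain \<phi> u v where \<phi>: "strict_mono \<phi>" "continuous_on UNIV \<phi>" "\<phi> 0 = 0"
    and tr: "tradeoff (\<lambda>f. \<phi> (CE f)) A u" "tradeoff (\<lambda>f. \<phi> (CE f)) B v"
    using tradeoff_rep_exists[OF A B C disj(1)] by blast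
  define V where "V f = \<phi> (CE f)" for f
  interpret tradeoff_rep M R V
  proof
    show "R f g \<longleftrightarrow> V g \<le> V f" if "f \<in> Linf M" "g \<in> Linf M" for f g
      using pref_iff_CE[OF that] \<phi>(1) by (simp add: V_def strict_mono_less_eq)
    show "(\<lambda>n. V (fs n)) \<longlonglongrightarrow> V f"
      if "\<And>n. fs n \<in> Linf M" "f \<in> Linf M" "\<And>n \<omega>. \<bar>fs n \<omega>\<bar> \<le> B" "\<And>\<omega>. (\<lambda>n. fs n \<omega>) \<longlonglongrightarrow> f \<omega>" for fs f B
      unfolding V_def using continuous_on_tendsto_compose[OF \<phi>(2) CE_cont[OF that]] by simp
  qed
  have V0: "V (\<lambda>_. 0) = 0" by (simp add: V_def \<phi>(3))
  interpret additive_functional M V "null_events M R"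
  proof
    show "V (mix D f h) = V (mix D f (\<lambda>_. 0)) + V (mix (- D) h (\<lambda>_. 0))"
      if "D \<in> sets M" "f \<in> Linf M" "h \<in> Linf M" for D f h
    proof -
      \<comment> \<open>Replacing \<open>0\<close> by \<open>f\<close> on \<open>D\<close> has the
        same effect whether \<open>h\<close> or \<open>0\<close> stands outside \<open>D\<close>;
        this is exactly the splitting of \<open>V\<close>.\<close>
      have "V (mix D f h) - V (mix D (\<lambda>_. 0) h) = V (mix D f (\<lambda>_. 0)) - V (mix D (\<lambda>_. 0) (\<lambda>_. 0))"
        using tr that disj(1) unfolding V_def[symmetric, abs_def]
        by (intro increment_indep[of A u B v]) auto
      moreover have "mix D (\<lambda>_. 0) h = mix (- D) h (\<lambda>_. 0)" "mix D (\<lambda>_. 0) (\<lambda>_. 0) = (\<lambda>_. 0::real)"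
        by (auto simp: mix_def fun_eq_iff)
      ultimately show ?thesis using V0 by simp
    qed
    show "V (mix D (\<lambda>_. x) (\<lambda>_. 0)) < V (mix D (\<lambda>_. y) (\<lambda>_. 0))" if "D \<in> sets M - null_events M R" "x < y" for D x y
      using CE_strict[OF that(1) _ that(2)] \<phi>(1) by (simp add: V_def strict_mono_less)
    show "V (mix D (\<lambda>_. x) (\<lambda>_. 0)) = 0" if "D \<in> null_events M R" for D x
    proof -
      have D: "D \<in> sets M" "indiff R (mix D (\<lambda>_. x) (\<lambda>_. 0)) (\<lambda>_. 0)"
        using that unfolding null_events_def by auto
      then show ?thesis
        using V_rep[of "mix D (\<lambda>_. x) (\<lambda>_. 0)" "\<lambda>_. 0"] V_rep[of "\<lambda>_. 0" "mix D (\<lambda>_. x) (\<lambda>_. 0)"] V0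
        by (auto simp: indiff_def)
    qed
    show "null_events M R \<subseteq> sets M" by (auto simp: null_events_def)
    show "(\<lambda>n. V (fs n)) \<longlonglongrightarrow> V f"
      if "\<And>n. fs n \<in> Linf M" "f \<in> Linf M" "\<And>n \<omega>. \<bar>fs n \<omega>\<bar> \<le> B" "\<And>\<omega>. (\<lambda>n. fs n \<omega>) \<longlonglongrightarrow> f \<omega>" for fs f B
      using that by (rule V_cont)
  qed (use assms(1) V0 nontrivial in auto)
  obtain P w where P: "prob_space P" "sets P = sets M" "\<And>D. D \<in> sets M \<Longrightarrow> measure P D = 0 \<longleftrightarrow> D \<in> null_events M R"
    "F_regular M w" and rep: "\<And>f. f \<in> Linf M \<Longrightarrow> integrable P (\<lambda>\<omega>. w \<omega> (f \<omega>)) \<and> V f = (\<integral>\<omega>. w \<omega> (f \<omega>) \<partial>P)"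
    using integral_representation by blast
  have "null_events M R = {A \<in> sets M. measure P A = 0}" using P(3) N_sets by auto
  moreover have "integrable P (\<lambda>\<omega>. w \<omega> x)" for x using rep[of "\<lambda>_. x"] by simp
  moreover have "R f g \<longleftrightarrow> (\<integral>\<omega>. w \<omega> (f \<omega>) \<partial>P) \<ge> (\<integral>\<omega>. w \<omega> (g \<omega>) \<partial>P)"
    if "f \<in> Linf M" "g \<in> Linf M" for f g using V_rep[OF that] rep that by simp
  ultimately show ?thesis using P(1,2,4) by blast
qed

end
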